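(* Let $A\subseteq\mathbb{R}$ be a finite set, and let $\varepsilon\in[0,1)$ be a real number. Suppose that $|AA|=M|A|$, $M\ge1$, and $$\left|\{x\ne0:\ (A\circ A)(x)\ge|A|^{1-\varepsilon}\}\right|\ll(M\log M)^{\frac53}\,|A|^{\frac16-\frac{\varepsilon}{4}}\,\log^{\frac56}|A|.$$ Then $$\mathsf{E}(A)\ll M\log M\,|A|^{\frac52-\frac{\varepsilon}{12}}\,\log^{\frac12}|A|.$$
   Context: $AA=\{ab:a,b\in A\}$. $(A\circ A)(x)=|\{(a,a')\in A\times A:a'-a=x\}|$. $\mathsf{E}(A)=|\{(a,b,c,d)\in A^4:a+b=c+d\}|$ is the additive energy. Logarithms are to base $2$. The symbol $\ll$ is the usual Vinogradov symbol ($X\ll Y$ means $X\le CY$ for some absolute constant $C>0$).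
   Formalization: The formal theorem assumes M > 1 instead of M ≥ 1: at M = 1 one has log M = 0, so the claim would read E(A) ≤ 0, which fails for every nonempty A (e.g. A = {−1, 1} meets all the hypotheses with M = 1). *)

theory Defs
  imports "HOL-Analysis.Analysis" "HOL-Library.Set_Algebras"
begin

definition diff_conv :: "real set \<Rightarrow> real \<Rightarrow> nat" where
  "diff_conv A x = card {(a, a'). a \<in> A \<and> a' \<in> A \<and> a' - a = x}"

definition additive_energy :: "real set \<Rightarrow> nat" where
  "additive_energy A =
     card {(a, b, c, d). a \<in> A \<and> b \<in> A \<and> c \<in> A \<and> d \<in> A \<and> a + b = c + d}"

end

theory Submission
  imports Defs
begin

text \<open>
  A grid version of the Szemeredi--Trotter theorem, applied to the lines \<open>u = c (x + b)\<close> with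
  \<open>c \<in> A\<close>, \<open>b \<in> B\<close> and \<open>u \<in> AA\<close>, bounds the number of \<open>x\<close> with at least \<open>t\<close> representations
  \<open>x = a - b\<close> by \<open>O(M\<^sup>2 |A| |B|\<^sup>2 / t\<^sup>3)\<close>. Let \<open>D\<close> be the set of differences with at least \<open>\<Delta>\<close>
  representations in \<open>A - A\<close>. Counting triples in \<open>A\<close> with two differences in \<open>D\<close>, weighted by the
  number of representations of the third, gives a lower bound in terms of \<open>|D|\<close> since the weights
  form a positive semidefinite matrix, and an upper bound by the Cauchy--Schwarz inequality and the
  incidence bounds. Comparing the two yields
  \<open>\<Delta>\<^sup>3\<^sup>7 |D|\<^sup>2\<^sup>1 = O(M\<^sup>1\<^sup>8 |A|\<^sup>4\<^sup>9 log\<^sup>4 |A|)\<close>, which controls the differences with few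
  representations. Those with moderately many are controlled by the third moment, and those with at
  least \<open>|A|\<^bsup>1-\<epsilon>\<^esup>\<close> by hypothesis.
\<close>

section \<open>Incidences in a grid\<close>

text \<open>Integer division of the rank within \<open>U\<close> by \<open>k\<close> works: elements
  of \<open>U\<close> have distinct ranks, so a fibre injects into an interval of \<open>k\<close>
  integers. The map is monotone on the whole type, so it can be composed with lines that leave
  \<open>U\<close>.\<close>

lemma rank_blocks:
  fixes U :: "'a::linorder set"
  assumes "finite U" "k > 0"
  obtains g :: "'a \<Rightarrow> nat" where "mono g" "\<And>i. card {u\<in>U. g u = i} \<le> k"
    "\<And>u. g u \<le> card U div k"
proof -
  define rank where "rank u = card {v\<in>U. v < u}" for u
  let ?g = "\<lambda>u. rank u div k"
  have rank_mono: "rank u \<le> rank v" if "u \<le> v" for u v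
    unfolding rank_def using that \<open>finite U\<close> by (intro card_mono) auto
  then have mono: "mono ?g" by (auto intro!: monoI div_le_mono)
  have rank_less: "rank u < rank v" if "u \<in> U" "u < v" for u v
    unfolding rank_def using that \<open>finite U\<close> by (intro psubset_card_mono) auto
  then have inj: "inj_on rank U"
    by (intro linorder_inj_onI') (auto dest: rank_less)
  have fibre: "card {u\<in>U. ?g u = i} \<le> k" for i
  proof -
    have "rank ` {u\<in>U. ?g u = i} \<subseteq> {i * k..<i * k + k}"
    proof (rule image_subsetI)
      fix u assume "u \<in> {u\<in>U. ?g u = i}"
      then have "rank u = i * k + rank u mod k" by auto
      moreover have "rank u mod k < k" using \<open>k > 0\<close> by simp
      ultimately show "rank u \<in> {i * k..<i * k + k}" by simp
    qed
    then have "card (rank ` {u\<in>U. ?g u = i}) \<le> k"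
      using card_mono[of "{i * k..<i * k + k}"] by fastforce
    moreover have "inj_on rank {u\<in>U. ?g u = i}" using inj by (auto intro: inj_on_subset)
    ultimately show ?thesis by (simp add: card_image)
  qed
  have "?g u \<le> card U div k" for u
    unfolding rank_def using \<open>finite U\<close> by (intro div_le_mono card_mono) auto
  with mono fibre show thesis by (rule that)
qed

text \<open>Fix one representative in each fibre of \<open>f\<close>; pairing every other element
  with the representative of its fibre produces distinct collisions.\<close>

lemma card_le_image_plus_collisions:
  assumes "finite S"
  shows "card S \<le> card (f ` S) + card {(x, y). x \<in> S \<and> y \<in> S \<and> x \<noteq> y \<and> f x = f y}"
proof -
  define s where "s v = (SOME x. x \<in> S \<and> f x = v)" for v
  have s: "s (f x) \<in> S \<and> f (s (f x)) = f x" if "x \<in> S" for x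
    unfolding s_def by (rule someI[where x = x]) (use that in auto)
  let ?R = "S - s ` f ` S"
  let ?Z = "{(x, y). x \<in> S \<and> y \<in> S \<and> x \<noteq> y \<and> f x = f y}"
  have "?Z \<subseteq> S \<times> S" by auto
  then have "finite ?Z" using assms by (meson finite_SigmaI finite_subset)
  moreover have "(\<lambda>x. (x, s (f x))) ` ?R \<subseteq> ?Z" using s by auto
  moreover have "inj_on (\<lambda>x. (x, s (f x))) ?R" by (auto intro: inj_onI)
  ultimately have "card ?R \<le> card ?Z" by (meson card_inj_on_le)
  moreover have "card (s ` f ` S) \<le> card (f ` S)" using assms by (intro card_image_le) auto
  moreover have "card S \<le> card (s ` f ` S) + card ?R"
  proof -
    have "card S \<le> card (s ` f ` S \<union> ?R)" using assms by (intro card_mono) auto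
    also have "\<dots> \<le> card (s ` f ` S) + card ?R" by (rule card_Un_le)
    finally show ?thesis .
  qed
  ultimately show ?thesis by linarith
qed

text \<open>A monotone path through a grid visits pairwise comparable cells, which are separated by
  the sum of their coordinates.\<close>

lemma card_image_monotone_cells:
  fixes p q :: "real \<Rightarrow> nat"
  assumes "mono_on S p" "mono_on S q" "\<And>x. x \<in> S \<Longrightarrow> p x \<le> a" "\<And>x. x \<in> S \<Longrightarrow> q x \<le> b"
  shows "card ((\<lambda>x. (p x, q x)) ` S) \<le> a + b + 1"
proof -
  let ?V = "(\<lambda>x. (p x, q x)) ` S"
  have "inj_on (\<lambda>(i, j). i + j) ?V"
  proof (rule inj_onI, clarsimp)
    fix x y assume *: "x \<in> S" "y \<in> S" "p x + q x = p y + q y"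
    show "p x = p y \<and> q x = q y"
    proof (cases "x \<le> y")
      case True
      then have "p x \<le> p y" "q x \<le> q y" using * assms(1,2) by (auto dest: mono_onD)
      then show ?thesis using * by linarith
    next
      case False
      then have "p y \<le> p x" "q y \<le> q x" using * assms(1,2) by (auto dest: mono_onD)
      then show ?thesis using * by linarith
    qed
  qed
  then have "card ?V = card ((\<lambda>(i, j). i + j) ` ?V)" by (simp add: card_image)
  also have "\<dots> \<le> card {..a + b}" using assms(3,4) by (intro card_mono) (auto intro: add_mono)
  finally show ?thesis by simp
qed

text \<open>The Szemeredi--Trotter bound for points in a grid. Cutting the grid by axis-parallel lines
  plays the role of a cell decomposition: a line meets few cells, and two points in one cell
  determine the line.\<close>

lemma grid_incidences:
  fixes U X :: "real set" and L :: "(real \<times> real) set"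
  assumes fin: "finite U" "finite X" "finite L" and nz: "\<And>c b. (c, b) \<in> L \<Longrightarrow> c \<noteq> 0"
    and k: "k > 0" "k' > 0"
  shows "(\<Sum>(c, b)\<in>L. card {x\<in>X. c * (x + b) \<in> U})
    \<le> card L * (card U div k + card X div k' + 1) + card X * k' * (card U * k)"
proof -
  obtain g :: "real \<Rightarrow> nat" where g: "mono g" "\<And>i. card {u\<in>U. g u = i} \<le> k"
    "\<And>u. g u \<le> card U div k" using rank_blocks fin k by metis
  obtain h :: "real \<Rightarrow> nat" where h: "mono h" "\<And>i. card {u\<in>X. h u = i} \<le> k'"
    "\<And>u. h u \<le> card X div k'" using rank_blocks fin k by metis
  define S where "S = (\<lambda>(c, b). {x\<in>X. c * (x + b) \<in> U})"
  define \<phi> where "\<phi> = (\<lambda>(c, b) x. (g (c * (x + b)), h x))"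
  define Z where "Z l = {(x, y). x \<in> S l \<and> y \<in> S l \<and> x \<noteq> y \<and> \<phi> l x = \<phi> l y}" for l
  have finS: "finite (S l)" for l using fin by (auto simp: S_def split: prod.split)
  have finZ: "finite (Z l)" for l
    by (rule finite_subset[of _ "S l \<times> S l"]) (auto simp: Z_def finS)
  have cells: "card (\<phi> l ` S l) \<le> card U div k + card X div k' + 1" if "l \<in> L" for l
  proof -
    obtain c b where l: "l = (c, b)" by force
    then have "c \<noteq> 0" using nz that by auto
    show ?thesis
    proof (cases "c > 0")
      case True
      have "card ((\<lambda>x. (g (c * (x + b)), h x)) ` S l) \<le> card U div k + card X div k' + 1"
        using g h True
        by (intro card_image_monotone_cells mono_onI) (auto intro!: monoD[OF g(1)] monoD[OF h(1)])
      then show ?thesis by (simp add: \<phi>_def l)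
    next
      case False
      \<comment> \<open>For negative \<open>c\<close> the first cell coordinate decreases along the
        line. Reflecting it in \<open>a\<close> restores monotonicity, and no information is lost to
        truncated subtraction because \<open>g\<close> never exceeds \<open>a\<close>.\<close>
      define a where "a = card U div k"
      have "card ((\<lambda>x. (a - g (c * (x + b)), h x)) ` S l) \<le> a + card X div k' + 1"
        using g h False
        by (intro card_image_monotone_cells mono_onI)
           (auto intro!: diff_le_mono2 monoD[OF g(1)] monoD[OF h(1)] mult_left_mono_neg)
      moreover have "(\<lambda>x. (a - g (c * (x + b)), h x)) ` S l = (\<lambda>(i, j). (a - i, j)) ` \<phi> l ` S l"
        by (simp add: image_image \<phi>_def l)
      moreover have "inj_on (\<lambda>(i, j). (a - i, j)) (\<phi> l ` S l)"
      proof (rule inj_onI, clarsimp simp: \<phi>_def l)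
        fix x y assume "a - g (c * (x + b)) = a - g (c * (y + b))"
        moreover have "g (c * (x + b)) \<le> a" "g (c * (y + b)) \<le> a" by (simp_all add: a_def g)
        ultimately show "g (c * (x + b)) = g (c * (y + b))" by linarith
      qed
      ultimately show ?thesis by (simp add: card_image a_def)
    qed
  qed
  \<comment> \<open>\<open>W\<close> collects the pairs of grid points sharing a cell. A point has
    at most \<open>k' * k\<close> cell mates, itself included.\<close>
  define W where "W = (SIGMA (x, u) : X \<times> U. {y\<in>X. h y = h x} \<times> {v\<in>U. g v = g u})"
  have "card W = (\<Sum>(x, u)\<in>X \<times> U. card {y\<in>X. h y = h x} * card {v\<in>U. g v = g u})"
    unfolding W_def using fin by (subst card_SigmaI) (auto simp: card_cartesian_product split_def)
  also have "\<dots> \<le> (\<Sum>(x, u)\<in>X \<times> U. k' * k)"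
    using g h by (intro sum_mono) (auto intro!: mult_mono)
  finally have cardW: "card W \<le> card X * k' * (card U * k)"
    by (simp add: card_cartesian_product split_def algebra_simps)
  have finW: "finite W" unfolding W_def using fin by (auto intro!: finite_SigmaI)
  \<comment> \<open>A collision on a line goes to its two grid points. Their distinct abscissae
    determine the slope \<open>c\<close>, and then \<open>b\<close> since \<open>c\<close> is
    nonzero, so no pair of points is used by two lines.\<close>
  let ?\<psi> = "\<lambda>((c, b), (x, y)). ((x, c * (x + b)), (y, c * (y + b)))"
  have "card (SIGMA l:L. Z l) \<le> card W"
  proof (rule card_inj_on_le[of ?\<psi>])
    show "?\<psi> ` (SIGMA l:L. Z l) \<subseteq> W"
      by (auto simp: Z_def S_def \<phi>_def W_def)
    show "inj_on ?\<psi> (SIGMA l:L. Z l)"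
    proof (rule inj_onI, clarsimp)
      fix c b x y c' b'
      assume *: "(c, b) \<in> L" "(x, y) \<in> Z (c, b)" "(c', b') \<in> L"
        "c * (x + b) = c' * (x + b')" "c * (y + b) = c' * (y + b')"
      have "x \<noteq> y" using *(2) by (auto simp: Z_def)
      moreover have "c * (x - y) = c' * (x - y)" using *(4,5) by (simp add: algebra_simps)
      ultimately have "c = c'" by simp
      then show "c = c' \<and> b = b'" using *(1,4) nz by auto
    qed
  qed (rule finW)
  then have pairs: "(\<Sum>l\<in>L. card (Z l)) \<le> card X * k' * (card U * k)"
    using cardW fin finZ by (simp add: card_SigmaI)
  have "(\<Sum>(c, b)\<in>L. card {x\<in>X. c * (x + b) \<in> U}) = (\<Sum>l\<in>L. card (S l))"
    by (simp add: S_def split_def)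
  also have "\<dots> \<le> (\<Sum>l\<in>L. (card U div k + card X div k' + 1) + card (Z l))"
  proof (rule sum_mono)
    fix l assume "l \<in> L"
    have "card (S l) \<le> card (\<phi> l ` S l) + card (Z l)"
      unfolding Z_def by (rule card_le_image_plus_collisions[OF finS])
    then show "card (S l) \<le> (card U div k + card X div k' + 1) + card (Z l)"
      using cells[OF \<open>l \<in> L\<close>] by linarith
  qed
  also have "\<dots> = card L * (card U div k + card X div k' + 1) + (\<Sum>l\<in>L. card (Z l))"
    by (subst sum.distrib) simp
  finally show ?thesis using pairs by linarith
qed

text \<open>Here \<open>s\<close> is the approximate number of blocks per axis. Block sizes are
  \<open>card U / s\<close> and \<open>card X / s\<close> rounded up; both quotients are at least 1,
  so each rounding costs at most a factor 2, whence the 4. The 3 comes from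
  \<open>s + s + 1 \<le> 3 * s\<close>.\<close>

lemma grid_incidences_real:
  fixes U X :: "real set" and L :: "(real \<times> real) set" and s :: real
  assumes fin: "finite U" "finite X" "finite L" and nz: "\<And>c b. (c, b) \<in> L \<Longrightarrow> c \<noteq> 0"
    and s: "1 \<le> s" "s \<le> card U" "s \<le> card X"
  shows "(\<Sum>(c, b)\<in>L. real (card {x\<in>X. c * (x + b) \<in> U}))
    \<le> 3 * s * card L + 4 * (real (card U) * card X)\<^sup>2 / s\<^sup>2"
proof -
  have blocks: "\<exists>k>0. real (m div k) \<le> s \<and> real k \<le> 2 * m / s" if "s \<le> real m" for m :: nat
  proof (intro exI conjI)
    let ?k = "nat \<lceil>m / s\<rceil>"
    have "m / s \<ge> 1" using that s by simp
    then show "?k > 0" by linarith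
    have "m / s \<le> ?k" by linarith
    define k where "k = real ?k"
    have k: "k > 0" "m / s \<le> k" using \<open>?k > 0\<close> \<open>m / s \<le> ?k\<close> unfolding k_def by linarith+
    have "real (m div ?k) \<le> m / k"
      unfolding k_def by (rule of_nat_div_le_of_nat)
    also have "\<dots> \<le> s" using k s by (simp add: field_simps)
    finally show "real (m div ?k) \<le> s" .
    show "real ?k \<le> 2 * m / s" using \<open>m / s \<ge> 1\<close> by linarith
  qed
  obtain k where k: "k > 0" "real (card U div k) \<le> s" "real k \<le> 2 * card U / s"
    using blocks s(2) by blast
  obtain k' where k': "k' > 0" "real (card X div k') \<le> s" "real k' \<le> 2 * card X / s"
    using blocks s(3) by blast
  have "real (\<Sum>(c, b)\<in>L. card {x\<in>X. c * (x + b) \<in> U})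
    \<le> real (card L * (card U div k + card X div k' + 1) + card X * k' * (card U * k))"
    using grid_incidences[OF fin nz k(1) k'(1)] by (simp only: of_nat_le_iff)
  then have "(\<Sum>(c, b)\<in>L. real (card {x\<in>X. c * (x + b) \<in> U}))
    \<le> card L * (real (card U div k) + real (card X div k') + 1) + card X * real k' * (card U * real k)"
    by (simp add: split_def distrib_left)
  also have "\<dots> \<le> card L * (s + s + s) + card X * (2 * card X / s) * (card U * (2 * card U / s))"
    using k k' s by (intro add_mono mult_mono) auto
  also have "\<dots> = 3 * s * card L + 4 * (real (card U) * card X)\<^sup>2 / s\<^sup>2"
    by (simp add: power2_eq_square field_simps)
  finally show ?thesis .
qed

section \<open>Representations as differences\<close>

text \<open>The number of pairs in \<open>A \<times> B\<close> with difference \<open>x\<close>,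
  recorded through the second component alone.\<close>

definition rep :: "real set \<Rightarrow> real set \<Rightarrow> real \<Rightarrow> nat" where
  "rep A B x = card {b\<in>B. b + x \<in> A}"

definition diff_set :: "real set \<Rightarrow> real set \<Rightarrow> real set" where
  "diff_set A B = (\<lambda>(a, b). a - b) ` (A \<times> B)"

text \<open>The common additive energy of \<open>A\<close> and \<open>B\<close>: the number of
  solutions of \<open>a - b = a' - b'\<close>.\<close>

definition energy :: "real set \<Rightarrow> real set \<Rightarrow> real" where
  "energy A B = (\<Sum>x\<in>diff_set A B. (real (rep A B x))\<^sup>2)"

lemma finite_diff_set [simp]: "finite A \<Longrightarrow> finite B \<Longrightarrow> finite (diff_set A B)"
  by (simp add: diff_set_def)

lemma rep_sum: "finite B \<Longrightarrow> real (rep A B x) = (\<Sum>b\<in>B. of_bool (b + x \<in> A))"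
  by (simp add: rep_def of_bool_def sum.If_cases Int_def)

lemma rep_eq_0: "x \<notin> diff_set A B \<Longrightarrow> rep A B x = 0"
proof -
  assume "x \<notin> diff_set A B"
  moreover have "x \<in> diff_set A B" if "b \<in> B" "b + x \<in> A" for b
    unfolding diff_set_def using that by (intro image_eqI[of _ _ "(b + x, b)"]) auto
  ultimately have "{b\<in>B. b + x \<in> A} = {}" by blast
  then show ?thesis by (simp only: rep_def card.empty)
qed

lemma rep_le_right: "finite B \<Longrightarrow> rep A B x \<le> card B"
  unfolding rep_def by (intro card_mono) auto

lemma rep_le_left: "finite A \<Longrightarrow> rep A B x \<le> card A"
  unfolding rep_def by (rule card_inj_on_le[where f = "\<lambda>b. b + x"]) (auto intro: inj_onI)

lemma rep_minus: "rep A A (- x) = rep A A x"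
  unfolding rep_def
  by (rule bij_betw_same_card[where f = "\<lambda>b. b - x"])
     (auto intro!: bij_betwI[where g = "\<lambda>b. b + x"])

lemma diff_conv_eq_rep: "diff_conv A x = rep A A x"
  unfolding diff_conv_def rep_def
  by (rule bij_betw_same_card[where f = fst])
     (auto intro!: bij_betwI[where g = "\<lambda>b. (b, b + x)"])

text \<open>For fixed \<open>b\<close>, the substitution \<open>a = b + x\<close> matches the
  differences \<open>x\<close> with \<open>b + x \<in> A\<close> to the elements of
  \<open>A\<close>. This trades sums over differences for sums over pairs.\<close>

lemma sum_diff_set:
  fixes f :: "real \<Rightarrow> real \<Rightarrow> real"
  assumes "finite A" "finite B"
  shows "(\<Sum>x\<in>diff_set A B. \<Sum>b\<in>B. of_bool (b + x \<in> A) * f b x) = (\<Sum>b\<in>B. \<Sum>a\<in>A. f b (a - b))"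
proof -
  have "(\<Sum>x\<in>diff_set A B. of_bool (b + x \<in> A) * f b x) = (\<Sum>a\<in>A. f b (a - b))" if "b \<in> B" for b
  proof -
    have "(\<Sum>x\<in>diff_set A B. of_bool (b + x \<in> A) * f b x) = (\<Sum>x\<in>{x\<in>diff_set A B. b + x \<in> A}. f b x)"
      using assms by (simp add: sum_of_bool_mult_eq Int_def)
    also have "\<dots> = (\<Sum>a\<in>A. f b (a - b))"
      using that by (intro sum.reindex_bij_witness[where i = "\<lambda>a. a - b" and j = "\<lambda>x. b + x"])
        (auto simp: diff_set_def)
    finally show ?thesis .
  qed
  then show ?thesis by (subst sum.swap) simp
qed

lemma sum_rep_mult:
  fixes f :: "real \<Rightarrow> real"
  assumes "finite A" "finite B"
  shows "(\<Sum>x\<in>diff_set A B. rep A B x * f x) = (\<Sum>b\<in>B. \<Sum>a\<in>A. f (a - b))"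
  using sum_diff_set[OF assms, of "\<lambda>_. f"] assms by (simp add: rep_sum sum_distrib_right)

lemma sum_rep: "finite A \<Longrightarrow> finite B \<Longrightarrow> (\<Sum>x\<in>diff_set A B. real (rep A B x)) = real (card A) * card B"
  using sum_rep_mult[of A B "\<lambda>_. 1"] by simp

text \<open>The equation \<open>a - b = a' - b'\<close> is rearranged as
  \<open>a' - a = b' - b\<close>.\<close>

lemma energy_eq:
  assumes "finite A" "finite B"
  shows "energy A B = (\<Sum>b\<in>B. \<Sum>b'\<in>B. real (rep A A (b' - b)))"
proof -
  have "energy A B = (\<Sum>b\<in>B. \<Sum>a\<in>A. \<Sum>b'\<in>B. of_bool (b' + (a - b) \<in> A))"
    using sum_rep_mult[OF assms, of "\<lambda>x. rep A B x"] assms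
    by (simp add: energy_def power2_eq_square rep_sum)
  also have "\<dots> = (\<Sum>b\<in>B. \<Sum>b'\<in>B. \<Sum>a\<in>A. of_bool (a + (b' - b) \<in> A))"
    by (rule sum.cong[OF refl]) (subst sum.swap, simp add: algebra_simps)
  finally show ?thesis using assms by (simp add: rep_sum)
qed

lemma additive_energy_eq:
  assumes "finite A"
  shows "real (additive_energy A) = energy A A"
proof -
  have "energy A A = (\<Sum>b\<in>A. \<Sum>b'\<in>A. \<Sum>a\<in>A. of_bool (a + (b' - b) \<in> A))"
    using assms by (simp add: energy_eq rep_sum)
  also have "\<dots> = real (card {(b, b', a). b \<in> A \<and> b' \<in> A \<and> a \<in> A \<and> a + (b' - b) \<in> A})"
  proof -
    have "{(b, b', a). b \<in> A \<and> b' \<in> A \<and> a \<in> A \<and> a + (b' - b) \<in> A}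
      = (SIGMA b:A. SIGMA b':A. {a\<in>A. a + (b' - b) \<in> A})" by auto
    then show ?thesis using assms by (simp add: of_bool_def sum.If_cases Int_def)
  qed
  \<comment> \<open>In \<open>a + b' = c + b\<close> the entry \<open>c\<close> is determined by the
    other three.\<close>
  also have "card {(b, b', a). b \<in> A \<and> b' \<in> A \<and> a \<in> A \<and> a + (b' - b) \<in> A} = additive_energy A"
    unfolding additive_energy_def
    by (rule bij_betw_same_card[where f = "\<lambda>(b, b', a). (a, b', a + (b' - b), b)"])
       (auto intro!: bij_betwI[where g = "\<lambda>(a, b, c, d). (d, b, a)"] simp: algebra_simps)
  finally show ?thesis by simp
qed

text \<open>Grouping the pairs by their difference turns the sum into the inner product of
  \<open>rep A B\<close> and \<open>rep A C\<close>; the latter vanishes off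
  \<open>diff_set A C\<close>.\<close>

lemma energy_Cauchy_Schwarz:
  assumes "finite A" "finite B" "finite C"
  shows "(\<Sum>b\<in>B. \<Sum>a\<in>A. real (rep A C (a - b)))\<^sup>2 \<le> energy A B * energy A C"
proof -
  have "(\<Sum>b\<in>B. \<Sum>a\<in>A. real (rep A C (a - b)))\<^sup>2
    = (\<Sum>x\<in>diff_set A B. real (rep A B x) * rep A C x)\<^sup>2"
    using sum_rep_mult[OF assms(1,2), of "rep A C"] by simp
  also have "\<dots> \<le> (\<Sum>x\<in>diff_set A B. (real (rep A B x))\<^sup>2) * (\<Sum>x\<in>diff_set A B. (real (rep A C x))\<^sup>2)"
    by (rule Cauchy_Schwarz_ineq_sum)
  also have "(\<Sum>x\<in>diff_set A B. (real (rep A C x))\<^sup>2)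
    = (\<Sum>x\<in>diff_set A B \<inter> diff_set A C. (real (rep A C x))\<^sup>2)"
    using assms by (intro sum.mono_neutral_right) (auto simp: rep_eq_0)
  also have "\<dots> \<le> energy A C"
    unfolding energy_def using assms by (intro sum_mono2) auto
  finally show ?thesis
    unfolding energy_def by (simp add: mult_left_mono sum_nonneg)
qed

section \<open>Dyadic decomposition of moments\<close>

lemma power_le_dyadic_sum:
  fixes y u :: real
  assumes "0 < u" "u \<le> y" "y < 2 ^ J * u"
  shows "y ^ p \<le> (\<Sum>j<J. (2 ^ Suc j * u) ^ p * of_bool (2 ^ j * u \<le> y))"
proof -
  \<comment> \<open>The predecessor \<open>i\<close> of the least such exponent satisfies
    \<open>2 ^ i * u \<le> y < 2 ^ Suc i * u\<close>, and its single summand already dominates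
    \<open>y ^ p\<close>.\<close>
  define j where "j = (LEAST j. y < 2 ^ j * u)"
  have y: "y < 2 ^ j * u" unfolding j_def by (rule LeastI[where k = J]) (rule assms)
  have "j \<le> J" unfolding j_def by (rule Least_le) (rule assms)
  moreover have "j \<noteq> 0" using y assms by (cases j) auto
  ultimately obtain i where i: "j = Suc i" "i < J" by (cases j) auto
  have "\<not> y < 2 ^ i * u" using not_less_Least[of i "\<lambda>j. y < 2 ^ j * u"] i by (simp add: j_def)
  then have "y ^ p \<le> (2 ^ Suc i * u) ^ p * of_bool (2 ^ i * u \<le> y)"
    using y assms i by (auto intro!: power_mono)
  also have "\<dots> \<le> (\<Sum>j<J. (2 ^ Suc j * u) ^ p * of_bool (2 ^ j * u \<le> y))"
    using i assms by (intro member_le_sum) auto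
  finally show ?thesis .
qed

text \<open>Converts bounds on level sets of \<open>f\<close> into bounds on its moments: at each
  scale \<open>f\<close> is replaced by the upper end of its dyadic interval.\<close>

lemma sum_power_le_dyadic_sum:
  fixes f :: "'a \<Rightarrow> real" and u :: real
  assumes "finite S" "0 < u" "\<And>x. x \<in> S \<Longrightarrow> u \<le> f x" "\<And>x. x \<in> S \<Longrightarrow> f x < 2 ^ J * u"
    and w: "\<And>x. x \<in> S \<Longrightarrow> 0 \<le> w x"
  shows "(\<Sum>x\<in>S. w x * f x ^ p) \<le> (\<Sum>j<J. (2 ^ Suc j * u) ^ p * (\<Sum>x\<in>{x\<in>S. 2 ^ j * u \<le> f x}. w x))"
proof -
  have "(\<Sum>x\<in>S. w x * f x ^ p)
    \<le> (\<Sum>x\<in>S. w x * (\<Sum>j<J. (2 ^ Suc j * u) ^ p * of_bool (2 ^ j * u \<le> f x)))"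
    using assms by (intro sum_mono mult_left_mono power_le_dyadic_sum) auto
  also have "\<dots> = (\<Sum>j<J. (2 ^ Suc j * u) ^ p * (\<Sum>x\<in>S. w x * of_bool (2 ^ j * u \<le> f x)))"
    unfolding sum_distrib_left by (subst sum.swap) (simp add: mult_ac)
  also have "\<dots> = (\<Sum>j<J. (2 ^ Suc j * u) ^ p * (\<Sum>x\<in>{x\<in>S. 2 ^ j * u \<le> f x}. w x))"
    using assms by (simp add: Int_def)
  finally show ?thesis .
qed

section \<open>Walks along popular differences\<close>

text \<open>The inequality of arithmetic and geometric means, obtained by summing
  \<open>ln t \<le> t - 1\<close>.\<close>

lemma three_le_sum_if_prod_eq_1:
  fixes a b c :: real
  assumes "a > 0" "b > 0" "c > 0" "a * b * c = 1"
  shows "3 \<le> a + b + c"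
proof -
  have "ln a + ln b + ln c = 0" using assms by (simp flip: ln_mult_pos)
  moreover have "ln a \<le> a - 1" "ln b \<le> b - 1" "ln c \<le> c - 1"
    using assms by (simp_all add: ln_le_minus_one)
  ultimately show ?thesis by linarith
qed

text \<open>Sum over all edges \<open>xy\<close> the inequality \<open>3 \<le> \<alpha> d(x) d(y) + \<beta> / d(x) + \<beta> / d(y)\<close>, where
  \<open>\<alpha> \<beta>\<^sup>2 = 1\<close>.\<close>

lemma three_edge_walks:
  fixes P :: "'a \<Rightarrow> 'a \<Rightarrow> bool"
  assumes "finite V" and sym: "\<And>x y. P x y \<longleftrightarrow> P y x"
  defines "d \<equiv> \<lambda>x. \<Sum>y\<in>V. of_bool (P y x) :: real"
  shows "(\<Sum>x\<in>V. d x) ^ 3 \<le> (real (card V))\<^sup>2 * (\<Sum>x\<in>V. \<Sum>y\<in>V. of_bool (P x y) * (d x * d y))"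
proof -
  define e where "e = (\<Sum>x\<in>V. d x)"
  define W where "W = (\<Sum>x\<in>V. \<Sum>y\<in>V. of_bool (P x y) * (d x * d y))"
  define n where "n = real (card V)"
  have d0: "d x \<ge> 0" for x unfolding d_def by (intro sum_nonneg) auto
  have "W \<ge> 0" unfolding W_def by (intro sum_nonneg mult_nonneg_nonneg) (auto simp: d0)
  show ?thesis
  proof (cases "e = 0")
    case True
    then show ?thesis using \<open>W \<ge> 0\<close> by (simp add: e_def W_def)
  next
    case False
    then have "e > 0" unfolding e_def using sum_nonneg[of V d] d0 by simp
    then have "V \<noteq> {}" by (auto simp: e_def)
    then have "n > 0" using \<open>finite V\<close> by (simp add: n_def card_gt_0_iff)
    \<comment> \<open>\<open>\<beta>\<close> is the average degree and \<open>\<alpha>\<close> its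
      inverse square, so the edge inequality is an equality on regular graphs.\<close>
    define \<alpha> where "\<alpha> = n\<^sup>2 / e\<^sup>2"
    define \<beta> where "\<beta> = e / n"
    have \<alpha>: "\<alpha> > 0" "\<beta> > 0" "\<alpha> * \<beta>\<^sup>2 = 1"
      using \<open>e > 0\<close> \<open>n > 0\<close> by (simp_all add: \<alpha>_def \<beta>_def power_divide)
    have edge: "3 * of_bool (P x y) \<le> \<alpha> * (of_bool (P x y) * (d x * d y))
        + \<beta> * (of_bool (P x y) / d x) + \<beta> * (of_bool (P x y) / d y)"
      if "x \<in> V" "y \<in> V" for x y
    proof (cases "P x y")
      case True
      have pos: "d u > 0" if "u \<in> V" "v \<in> V" "P v u" for u v
        unfolding d_def using that \<open>finite V\<close> by (intro sum_pos2[of V v]) auto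
      have "d x > 0" "d y > 0" using pos that True sym by blast+
      then have "3 \<le> \<alpha> * (d x * d y) + \<beta> / d x + \<beta> / d y"
        using \<alpha> by (intro three_le_sum_if_prod_eq_1) (auto simp: power2_eq_square field_simps)
      then show ?thesis using True by simp
    qed simp
    have inv: "(\<Sum>x\<in>V. \<Sum>y\<in>V. of_bool (P y x) / d x) \<le> n"
    proof -
      \<comment> \<open>The sum is 1, except at an isolated vertex, where division by zero gives
        0.\<close>
      have "(\<Sum>y\<in>V. of_bool (P y x) / d x) \<le> 1" for x
      proof -
        have "(\<Sum>y\<in>V. of_bool (P y x) / d x) = d x / d x"
          by (simp only: d_def sum_divide_distrib)
        then show ?thesis by simp
      qed
      then have "(\<Sum>x\<in>V. \<Sum>y\<in>V. of_bool (P y x) / d x) \<le> (\<Sum>x\<in>V. 1)" by (intro sum_mono)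
      then show ?thesis by (simp add: n_def)
    qed
    have "3 * (\<Sum>x\<in>V. \<Sum>y\<in>V. of_bool (P x y)) \<le> \<alpha> * W
        + \<beta> * (\<Sum>x\<in>V. \<Sum>y\<in>V. of_bool (P x y) / d x) + \<beta> * (\<Sum>x\<in>V. \<Sum>y\<in>V. of_bool (P x y) / d y)"
      unfolding W_def sum_distrib_left sum.distrib[symmetric] by (intro sum_mono edge)
    moreover have "(\<Sum>x\<in>V. \<Sum>y\<in>V. of_bool (P x y) / d x) \<le> n"
      using inv sym by simp
    moreover have "(\<Sum>x\<in>V. \<Sum>y\<in>V. of_bool (P x y) / d y) \<le> n"
      using inv by (subst sum.swap)
    moreover have "(\<Sum>x\<in>V. \<Sum>y\<in>V. of_bool (P x y)) = e"
      unfolding e_def d_def by (subst sum.swap) simp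
    ultimately have "3 * e \<le> \<alpha> * W + \<beta> * n + \<beta> * n"
      using \<alpha> by (smt (verit) mult_left_mono)
    then have "e \<le> n\<^sup>2 / e\<^sup>2 * W" using \<open>n > 0\<close> by (simp add: \<alpha>_def \<beta>_def)
    then have "e ^ 3 \<le> n\<^sup>2 * W"
      using \<open>e > 0\<close> by (simp add: field_simps power2_eq_square power3_eq_cube)
    then show ?thesis by (simp add: e_def W_def n_def)
  qed
qed

text \<open>The matrix with entries \<open>rep A A (y - z)\<close> is a Gram matrix.\<close>

lemma rep_quadratic_form:
  fixes f :: "real \<Rightarrow> real"
  assumes "finite A"
  shows "(\<Sum>y\<in>A. \<Sum>z\<in>A. f y * f z * rep A A (y - z))
    = (\<Sum>w\<in>diff_set A A. (\<Sum>y\<in>A. of_bool (w + y \<in> A) * f y)\<^sup>2)"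
proof -
  have rep: "real (rep A A (y - z)) = (\<Sum>w\<in>diff_set A A. of_bool (w + y \<in> A) * of_bool (w + z \<in> A))"
    if "z \<in> A" for y z
  proof -
    have "rep A A (y - z) = card {w\<in>diff_set A A. w + y \<in> A \<and> w + z \<in> A}"
      unfolding rep_def using that
      by (intro bij_betw_same_card[where f = "\<lambda>a. a - z"] bij_betwI[where g = "\<lambda>w. w + z"])
         (auto simp: diff_set_def algebra_simps)
    also have "real \<dots> = (\<Sum>w\<in>diff_set A A. of_bool (w + y \<in> A \<and> w + z \<in> A))"
      using assms by (simp add: Int_def)
    finally show ?thesis by (simp add: of_bool_conj)
  qed
  have "(\<Sum>y\<in>A. \<Sum>z\<in>A. f y * f z * rep A A (y - z))
    = (\<Sum>y\<in>A. \<Sum>z\<in>A. \<Sum>w\<in>diff_set A A. (of_bool (w + y \<in> A) * f y) * (of_bool (w + z \<in> A) * f z))"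
    by (intro sum.cong refl) (simp only: rep sum_distrib_left mult_ac)
  also have "\<dots> = (\<Sum>y\<in>A. \<Sum>w\<in>diff_set A A. \<Sum>z\<in>A. (of_bool (w + y \<in> A) * f y) * (of_bool (w + z \<in> A) * f z))"
    by (rule sum.cong[OF refl]) (rule sum.swap)
  also have "\<dots> = (\<Sum>w\<in>diff_set A A. \<Sum>y\<in>A. \<Sum>z\<in>A. (of_bool (w + y \<in> A) * f y) * (of_bool (w + z \<in> A) * f z))"
    by (rule sum.swap)
  also have "\<dots> = (\<Sum>w\<in>diff_set A A. (\<Sum>y\<in>A. of_bool (w + y \<in> A) * f y)\<^sup>2)"
    by (simp only: power2_eq_square sum_product)
  finally show ?thesis .
qed

lemma sum_reflect:
  fixes g :: "real \<Rightarrow> real"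
  assumes "finite A" "finite D"
  shows "(\<Sum>y\<in>A. of_bool (x - y \<in> D) * g y) = (\<Sum>d\<in>D. of_bool (x - d \<in> A) * g (x - d))"
proof -
  have "(\<Sum>y\<in>A. of_bool (x - y \<in> D) * g y) = (\<Sum>y\<in>{y\<in>A. x - y \<in> D}. g y)"
    using assms by (simp add: Int_def)
  also have "\<dots> = (\<Sum>d\<in>{d\<in>D. x - d \<in> A}. g (x - d))"
    by (rule sum.reindex_bij_witness[where i = "\<lambda>d. x - d" and j = "\<lambda>y. x - y"]) auto
  finally show ?thesis using assms by (simp add: Int_def)
qed

text \<open>Expanding the square and summing over \<open>d\<close>, \<open>d'\<close> first leaves,
  for each pair \<open>x\<close>, \<open>x'\<close>, the square of the number of \<open>d\<close>
  with \<open>x - d\<close> and \<open>x' - d\<close> in \<open>A\<close>. That number is at most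
  \<open>rep A A (x' - x)\<close>, and summing its square over pairs gives the third moment.\<close>

lemma common_translates_second_moment:
  assumes "finite A" "finite D"
  shows "(\<Sum>d\<in>D. \<Sum>d'\<in>D. (\<Sum>x\<in>A. of_bool (x - d \<in> A) * of_bool (x - d' \<in> A))\<^sup>2)
    \<le> (\<Sum>x\<in>diff_set A A. real (rep A A x) ^ 3)"
proof -
  define h :: "real \<Rightarrow> real \<Rightarrow> real" where "h d x = of_bool (x - d \<in> A)" for d x
  have inner: "(\<Sum>d\<in>D. h d x * h d x') \<le> rep A A (x' - x)" for x x'
  proof -
    have "(\<Sum>d\<in>D. h d x * h d x') = card {d\<in>D. x - d \<in> A \<and> x' - d \<in> A}"
      using assms by (simp add: h_def Int_def flip: of_bool_conj)
    also have "card {d\<in>D. x - d \<in> A \<and> x' - d \<in> A} \<le> rep A A (x' - x)"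
      unfolding rep_def using assms
      by (intro card_inj_on_le[where f = "\<lambda>d. x - d"]) (auto intro: inj_onI)
    finally show ?thesis by simp
  qed
  have "(\<Sum>d\<in>D. \<Sum>d'\<in>D. (\<Sum>x\<in>A. h d x * h d' x)\<^sup>2)
    = (\<Sum>d\<in>D. \<Sum>d'\<in>D. \<Sum>(x, x')\<in>A \<times> A. (h d x * h d x') * (h d' x * h d' x'))"
    by (simp add: power2_eq_square sum_product sum.cartesian_product mult_ac)
  also have "\<dots> = (\<Sum>d\<in>D. \<Sum>(x, x')\<in>A \<times> A. \<Sum>d'\<in>D. (h d x * h d x') * (h d' x * h d' x'))"
    by (rule sum.cong[OF refl], subst sum.swap) (simp add: split_def)
  also have "\<dots> = (\<Sum>(x, x')\<in>A \<times> A. \<Sum>d\<in>D. \<Sum>d'\<in>D. (h d x * h d x') * (h d' x * h d' x'))"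
    by (subst sum.swap) (simp add: split_def)
  also have "\<dots> = (\<Sum>x\<in>A. \<Sum>x'\<in>A. (\<Sum>d\<in>D. h d x * h d x')\<^sup>2)"
    by (simp only: power2_eq_square sum_product sum.cartesian_product[symmetric])
  also have "\<dots> \<le> (\<Sum>x\<in>A. \<Sum>x'\<in>A. (real (rep A A (x' - x)))\<^sup>2)"
    by (intro sum_mono power_mono inner sum_nonneg) (auto simp: h_def)
  also have "\<dots> = (\<Sum>x\<in>diff_set A A. real (rep A A x) ^ 3)"
    using sum_rep_mult[OF assms(1,1), of "\<lambda>x. (real (rep A A x))\<^sup>2"]
    by (simp add: power2_eq_square power3_eq_cube mult.assoc)
  finally show ?thesis by (simp add: h_def)
qed

text \<open>View \<open>A\<close> as a graph with edges the pairs whose difference lies in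
  \<open>D\<close>; the symmetry of \<open>D\<close> makes it undirected. The quantity
  \<open>G\<close>, counting pairs of edges from a common vertex \<open>x\<close> weighted by
  \<open>rep A A (y - z)\<close>, is bounded below by three-edge walks and above by
  Cauchy-Schwarz.\<close>

lemma popular_differences_moment:
  fixes A D :: "real set" and \<Delta> :: real
  assumes fin: "finite A" "finite D" and sym: "\<And>x. x \<in> D \<Longrightarrow> - x \<in> D"
    and \<Delta>: "\<Delta> \<ge> 0" "\<And>x. x \<in> D \<Longrightarrow> \<Delta> \<le> rep A A x"
  shows "(\<Delta> ^ 4 * real (card D) ^ 3)\<^sup>2 \<le> real (card A) ^ 6
    * ((\<Sum>x\<in>diff_set A A. real (rep A A x) ^ 3) * (\<Sum>d\<in>D. \<Sum>d'\<in>D. (real (rep A A (d' - d)))\<^sup>2))"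
proof -
  define n where "n = real (card A)"
  define t :: "real \<Rightarrow> real \<Rightarrow> real" where "t x y = of_bool (x - y \<in> D)" for x y
  define deg where "deg y = (\<Sum>x\<in>A. t x y)" for y
  define W where "W = (\<Sum>y\<in>A. \<Sum>z\<in>A. t y z * (deg y * deg z))"
  define G where "G = (\<Sum>x\<in>A. \<Sum>y\<in>A. \<Sum>z\<in>A. t x y * t x z * rep A A (y - z))"
  have deg0: "deg y \<ge> 0" for y unfolding deg_def t_def by (intro sum_nonneg) auto
  have symD: "x - y \<in> D \<longleftrightarrow> y - x \<in> D" for x y
    using sym[of "x - y"] sym[of "y - x"] by auto

  have edges: "(\<Sum>y\<in>A. deg y) \<ge> \<Delta> * card D"
  proof -
    have "\<Delta> * card D = (\<Sum>d\<in>D. \<Delta>)" by simp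
    also have "\<dots> \<le> (\<Sum>d\<in>D. real (rep A A d))" by (intro sum_mono \<Delta>)
    also have "\<dots> = (\<Sum>d\<in>D. real (rep A A (- d)))" by (simp add: rep_minus)
    also have "\<dots> = (\<Sum>d\<in>D. \<Sum>x\<in>A. of_bool (x - d \<in> A))" using fin by (simp only: rep_sum) simp
    also have "\<dots> = (\<Sum>x\<in>A. \<Sum>d\<in>D. of_bool (x - d \<in> A))" by (rule sum.swap)
    also have "\<dots> = (\<Sum>x\<in>A. \<Sum>y\<in>A. t x y)"
      using sum_reflect[OF fin, of _ "\<lambda>_. 1"] by (simp add: t_def)
    also have "\<dots> = (\<Sum>y\<in>A. deg y)" unfolding deg_def by (rule sum.swap)
    finally show ?thesis .
  qed
  have "(\<Delta> * card D) ^ 3 \<le> (\<Sum>y\<in>A. deg y) ^ 3" using edges \<Delta> by (intro power_mono) auto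
  also have "\<dots> \<le> n\<^sup>2 * W"
    using three_edge_walks[OF fin(1), of "\<lambda>x y. x - y \<in> D"] symD
    unfolding n_def W_def deg_def t_def by blast
  finally have walks: "(\<Delta> * card D) ^ 3 \<le> n\<^sup>2 * W" .

  \<comment> \<open>On the middle edge \<open>yz\<close> the indicator is at most
    \<open>rep A A (y - z) / \<Delta>\<close>. The resulting form in \<open>deg\<close> is a sum of
    squares, and \<open>deg\<close> is the sum over \<open>x\<close> of the rows \<open>t x\<close>,
    so Cauchy-Schwarz over \<open>x\<close> reduces it to \<open>G\<close> with a factor
    \<open>n\<close>.\<close>
  have "\<Delta> * W = (\<Sum>y\<in>A. \<Sum>z\<in>A. deg y * deg z * (\<Delta> * t y z))"
    unfolding W_def sum_distrib_left by (intro sum.cong refl) (simp add: mult_ac)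
  also have "\<dots> \<le> (\<Sum>y\<in>A. \<Sum>z\<in>A. deg y * deg z * rep A A (y - z))"
    using \<Delta> deg0 by (intro sum_mono mult_left_mono) (auto simp: t_def)
  also have "\<dots> = (\<Sum>w\<in>diff_set A A. (\<Sum>y\<in>A. of_bool (w + y \<in> A) * deg y)\<^sup>2)"
    by (rule rep_quadratic_form[OF fin(1)])
  also have "\<dots> = (\<Sum>w\<in>diff_set A A. (\<Sum>x\<in>A. 1 * (\<Sum>y\<in>A. of_bool (w + y \<in> A) * t x y))\<^sup>2)"
  proof -
    have "(\<Sum>y\<in>A. of_bool (w + y \<in> A) * deg y) = (\<Sum>x\<in>A. 1 * (\<Sum>y\<in>A. of_bool (w + y \<in> A) * t x y))" for w
      unfolding deg_def sum_distrib_left mult_1 by (rule sum.swap)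
    then show ?thesis by simp
  qed
  also have "\<dots> \<le> (\<Sum>w\<in>diff_set A A. (\<Sum>x\<in>A. 1\<^sup>2) * (\<Sum>x\<in>A. (\<Sum>y\<in>A. of_bool (w + y \<in> A) * t x y)\<^sup>2))"
    by (intro sum_mono Cauchy_Schwarz_ineq_sum)
  also have "\<dots> = n * (\<Sum>x\<in>A. \<Sum>w\<in>diff_set A A. (\<Sum>y\<in>A. of_bool (w + y \<in> A) * t x y)\<^sup>2)"
    by (subst sum.swap) (simp add: n_def sum_distrib_left)
  also have "\<dots> = n * G"
    unfolding G_def rep_quadratic_form[OF fin(1)] by simp
  finally have "\<Delta> * W \<le> n * G" .
  then have "n\<^sup>2 * (\<Delta> * W) \<le> n\<^sup>2 * (n * G)" by (intro mult_left_mono) auto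
  moreover have "\<Delta> * (\<Delta> * card D) ^ 3 \<le> \<Delta> * (n\<^sup>2 * W)" using walks \<Delta> by (intro mult_left_mono) auto
  ultimately have lower: "\<Delta> ^ 4 * real (card D) ^ 3 \<le> n ^ 3 * G"
    by (simp add: power_mult_distrib power2_eq_square power3_eq_cube power4_eq_xxxx mult_ac)

  \<comment> \<open>With \<open>y = x - d\<close> and \<open>z = x - d'\<close> the third difference
    \<open>y - z\<close> becomes \<open>d' - d\<close>, and \<open>x\<close> enters only through the
    count \<open>C d d'\<close>.\<close>
  define C where "C d d' = (\<Sum>x\<in>A. of_bool (x - d \<in> A) * of_bool (x - d' \<in> A) :: real)" for d d'
  have "G = (\<Sum>x\<in>A. \<Sum>y\<in>A. of_bool (x - y \<in> D) * (\<Sum>z\<in>A. of_bool (x - z \<in> D) * real (rep A A (y - z))))"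
    unfolding G_def t_def by (simp only: sum_distrib_left mult.assoc)
  also have "\<dots> = (\<Sum>x\<in>A. \<Sum>d\<in>D. of_bool (x - d \<in> A) * (\<Sum>d'\<in>D. of_bool (x - d' \<in> A) * real (rep A A (d' - d))))"
    by (simp only: sum_reflect[OF fin]) (simp add: algebra_simps)
  also have "\<dots> = (\<Sum>x\<in>A. \<Sum>d\<in>D. \<Sum>d'\<in>D. (of_bool (x - d \<in> A) * of_bool (x - d' \<in> A)) * real (rep A A (d' - d)))"
    by (simp only: sum_distrib_left mult.assoc)
  also have "\<dots> = (\<Sum>d\<in>D. \<Sum>x\<in>A. \<Sum>d'\<in>D. (of_bool (x - d \<in> A) * of_bool (x - d' \<in> A)) * real (rep A A (d' - d)))"
    by (rule sum.swap)
  also have "\<dots> = (\<Sum>d\<in>D. \<Sum>d'\<in>D. \<Sum>x\<in>A. (of_bool (x - d \<in> A) * of_bool (x - d' \<in> A)) * real (rep A A (d' - d)))"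
    by (rule sum.cong[OF refl]) (rule sum.swap)
  also have "\<dots> = (\<Sum>d\<in>D. \<Sum>d'\<in>D. C d d' * real (rep A A (d' - d)))"
    unfolding C_def by (simp only: sum_distrib_right)
  also have "\<dots> = (\<Sum>p\<in>D \<times> D. C (fst p) (snd p) * rep A A (snd p - fst p))"
    by (simp add: sum.cartesian_product split_def)
  finally have "G\<^sup>2 \<le> (\<Sum>p\<in>D \<times> D. (C (fst p) (snd p))\<^sup>2)
    * (\<Sum>p\<in>D \<times> D. (real (rep A A (snd p - fst p)))\<^sup>2)"
    using Cauchy_Schwarz_ineq_sum by metis
  also have "\<dots> = (\<Sum>d\<in>D. \<Sum>d'\<in>D. (C d d')\<^sup>2) * (\<Sum>d\<in>D. \<Sum>d'\<in>D. (real (rep A A (d' - d)))\<^sup>2)"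
    by (simp add: sum.cartesian_product split_def)
  also have "\<dots> \<le> (\<Sum>x\<in>diff_set A A. real (rep A A x) ^ 3)
    * (\<Sum>d\<in>D. \<Sum>d'\<in>D. (real (rep A A (d' - d)))\<^sup>2)"
    unfolding C_def
    by (intro mult_right_mono common_translates_second_moment[OF fin] sum_nonneg) auto
  finally have upper: "G\<^sup>2 \<le> (\<Sum>x\<in>diff_set A A. real (rep A A x) ^ 3)
    * (\<Sum>d\<in>D. \<Sum>d'\<in>D. (real (rep A A (d' - d)))\<^sup>2)" .

  have "(\<Delta> ^ 4 * real (card D) ^ 3)\<^sup>2 \<le> (n ^ 3 * G)\<^sup>2" using lower \<Delta> by (intro power_mono) auto
  also have "\<dots> = n ^ 6 * G\<^sup>2" by (simp add: power_mult_distrib flip: power_mult)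
  also have "\<dots> \<le> n ^ 6 * ((\<Sum>x\<in>diff_set A A. real (rep A A x) ^ 3)
    * (\<Sum>d\<in>D. \<Sum>d'\<in>D. (real (rep A A (d' - d)))\<^sup>2))"
    using upper by (intro mult_left_mono) (auto simp: n_def)
  finally show ?thesis by (simp add: n_def)
qed

section \<open>Sets with few products\<close>

text \<open>Dilating by elements of extremal absolute values gives two almost disjoint copies of \<open>A\<close>
  inside the product set, so \<open>M\<close> stays away from \<open>1\<close>.\<close>

lemma product_set_growth:
  fixes A :: "real set"
  assumes "finite A" "card A < card (A * A)"
  shows "6 / 5 * real (card A) \<le> card (A * A)"
\<comment> \<open>Up to five elements, one additional product is already growth by a fifth. For
  more, the two dilates give at least \<open>2 * card A - 4\<close> products.\<close>
proof (cases "card A \<le> 5")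
  case True
  then show ?thesis using assms by linarith
next
  case False
  define A0 where "A0 = A - {0}"
  have "finite A0" using assms by (simp add: A0_def)
  have "card A - 1 \<le> card A0" using diff_card_le_card_Diff[of "{0}" A] by (simp add: A0_def)
  with False have cardA0: "card A \<le> card A0 + 1" "A0 \<noteq> {}" by auto
  define p where "p = Min (abs ` A0)"
  define q where "q = Max (abs ` A0)"
  have "p \<in> abs ` A0" "q \<in> abs ` A0"
    unfolding p_def q_def using \<open>finite A0\<close> cardA0 by (auto intro: Min_in Max_in)
  then obtain a b where ab: "a \<in> A0" "\<bar>a\<bar> = p" "b \<in> A0" "\<bar>b\<bar> = q" by auto
  have pq: "p \<le> \<bar>x\<bar>" "\<bar>x\<bar> \<le> q" if "x \<in> A0" for x
    unfolding p_def q_def using that \<open>finite A0\<close> by auto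
  have dil: "card ((*) c ` A0) = card A0" if "c \<in> A0" for c
    using that by (intro card_image inj_onI) (auto simp: A0_def)
  \<comment> \<open>Absolute values are at most \<open>p * q\<close> in the first dilate and at
    least \<open>p * q\<close> in the second.\<close>
  have "(*) a ` A0 \<inter> (*) b ` A0 \<subseteq> {p * q, - (p * q)}"
  proof
    fix z assume "z \<in> (*) a ` A0 \<inter> (*) b ` A0"
    then obtain x y where *: "x \<in> A0" "y \<in> A0" "a * x = b * y" "z = b * y" by auto
    have "\<bar>a * x\<bar> = p * \<bar>x\<bar>" "\<bar>b * y\<bar> = q * \<bar>y\<bar>" "p \<ge> 0" "q \<ge> 0"
      using ab by (auto simp: abs_mult)
    moreover have "p * \<bar>x\<bar> \<le> p * q" "q * p \<le> q * \<bar>y\<bar>"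
      using pq * \<open>p \<ge> 0\<close> \<open>q \<ge> 0\<close> by (auto intro: mult_left_mono)
    moreover have "\<bar>a * x\<bar> = \<bar>b * y\<bar>" "q * p = p * q" using *(3) by simp_all
    ultimately have "\<bar>b * y\<bar> = p * q" by linarith
    then have "z = p * q \<or> z = - (p * q)" using *(4) by linarith
    then show "z \<in> {p * q, - (p * q)}" by simp
  qed
  then have "card ((*) a ` A0 \<inter> (*) b ` A0) \<le> card {p * q, - (p * q)}" by (intro card_mono) auto
  also have "\<dots> \<le> 2" by (simp add: card_insert_if)
  finally have "card ((*) a ` A0 \<inter> (*) b ` A0) \<le> 2" .
  moreover have "card ((*) a ` A0) + card ((*) b ` A0)
    = card ((*) a ` A0 \<union> (*) b ` A0) + card ((*) a ` A0 \<inter> (*) b ` A0)"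
    using \<open>finite A0\<close> by (intro card_Un_Int) auto
  moreover have "card ((*) a ` A0 \<union> (*) b ` A0) \<le> card (A * A)"
    using ab assms(1) by (intro card_mono) (auto simp: A0_def finite_set_times)
  ultimately have "2 * card A0 \<le> card (A * A) + 2" using dil ab by simp
  then show ?thesis using cardA0 False by linarith
qed

text \<open>Since \<open>(6/5)^4 = 1296/625\<close> exceeds 2. It allows \<open>M\<close> to be
  replaced by \<open>4 * M * log 2 M\<close>.\<close>

lemma log_ge_quarter:
  assumes "6 / 5 \<le> (M :: real)"
  shows "1 / 4 \<le> log 2 M"
proof -
  have "(2 powr (1/4)) ^ 4 \<le> (6 / 5 :: real) ^ 4" by (simp add: powr_power power_divide)
  then have "2 powr (1/4) \<le> (6 / 5 :: real)" by (rule power_le_imp_le_base[where n = 3, simplified]) auto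
  then have "2 powr (1/4) \<le> M" using assms by linarith
  then show ?thesis using assms by (subst le_log_iff) auto
qed

section \<open>Level sets, energies and third moment for a set with few products\<close>

locale few_products =
  fixes A :: "real set" and M :: real
  assumes finite_A: "finite A" and card_A: "card A \<ge> 2"
    and card_prod: "real (card (A * A)) \<le> M * card A" and M_ge_1: "M \<ge> 1"
begin

text \<open>If \<open>x + b \<in> A\<close> then \<open>c * (x + b)\<close> lies in
  \<open>A * A\<close> for every \<open>c \<in> A\<close>. Hence each \<open>x \<in> X\<close> gives
  at least \<open>t\<close> incidences for every nonzero \<open>c\<close>, and the grid bound limits
  their total.\<close>

lemma card_rep_ge:
  fixes t :: real
  assumes "finite B" "finite X" "t > 0" and X: "\<And>x. x \<in> X \<Longrightarrow> t \<le> rep A B x"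
  shows "card X * t ^ 3 \<le> 1024 * (M\<^sup>2 * card A * (card B)\<^sup>2)"
proof (cases "X = {}")
  case False
  define n where "n = real (card A)"
  define b where "b = real (card B)"
  have n: "n \<ge> 2" using card_A by (simp add: n_def)
  have M2: "1 \<le> M\<^sup>2" using M_ge_1 by (simp add: one_le_power)
  obtain x where "x \<in> X" using False by auto
  then have "t \<le> rep A B x" using X by auto
  moreover have "rep A B x \<le> card A" "rep A B x \<le> card B"
    using assms finite_A by (auto intro: rep_le_left rep_le_right)
  ultimately have tb: "t \<le> n" "t \<le> b" by (simp_all add: n_def b_def)
  have Xt: "card X * t \<le> n * b"
  proof -
    have "card X * t = (\<Sum>x\<in>X. t)" by simp
    also have "(\<Sum>x\<in>X. t) \<le> (\<Sum>x\<in>X. real (rep A B x))" by (intro sum_mono X)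
    also have "\<dots> \<le> (\<Sum>x\<in>diff_set A B. real (rep A B x))"
    proof (rule sum_mono2)
      show "X \<subseteq> diff_set A B" using X \<open>t > 0\<close> rep_eq_0 by force
    qed (use assms finite_A in auto)
    finally show ?thesis using sum_rep assms finite_A by (simp add: n_def b_def)
  qed
  show ?thesis
  \<comment> \<open>This disposes of the range where the \<open>s\<close> chosen below could fall
    under 1; there \<open>t\<le>n\<close> and \<open>t\<le>b\<close> suffice.\<close>
  proof (cases "card X * t \<le> 8 * b")
    case True
    have "t\<^sup>2 \<le> n * b" unfolding power2_eq_square using tb \<open>t > 0\<close> by (intro mult_mono) auto
    with True have "card X * t * t\<^sup>2 \<le> 8 * b * (n * b)"
      by (rule mult_mono) (auto simp: b_def)
    also have "\<dots> = 8 * 1 * (n * b\<^sup>2)" by (simp add: power2_eq_square)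
    also have "\<dots> \<le> 1024 * M\<^sup>2 * (n * b\<^sup>2)"
      using M2 n by (intro mult_right_mono) (auto simp: b_def)
    finally show ?thesis by (simp add: n_def b_def power2_eq_square power3_eq_cube mult_ac)
  next
    case False
    define L where "L = (A - {0}) \<times> B"
    define l where "l = real (card (A - {0}))"
    have l: "n \<le> 2 * l"
    proof -
      have "card A - 1 \<le> card (A - {0})" using diff_card_le_card_Diff[of "{0}" A] by simp
      then show ?thesis using card_A by (simp add: n_def l_def)
    qed
    then have "l > 0" using n by simp
    have "b > 0" using tb \<open>t > 0\<close> by simp
    \<comment> \<open>With this value \<open>4 * s * card L\<close> is exactly half of the lower
      bound for the incidences and can be absorbed.\<close>
    define s where "s = card X * t / (8 * b)"
    define U where "U = A * A"
    have "finite U" unfolding U_def using finite_A by (simp add: finite_set_times)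
    have "n \<le> card U"
    proof -
      have "A - {0} \<noteq> {}" using \<open>l > 0\<close> unfolding l_def of_nat_0_less_iff card_gt_0_iff by blast
      then obtain c where "c \<in> A - {0}" by blast
      then have "card A = card ((*) c ` A)" by (subst card_image) (auto intro: inj_onI)
      also have "\<dots> \<le> card U"
        using \<open>finite U\<close> \<open>c \<in> A - {0}\<close> by (intro card_mono) (auto simp: U_def)
      finally show ?thesis by (simp add: n_def)
    qed
    have s: "1 \<le> s" "s \<le> card U" "s \<le> card X"
    proof -
      show "1 \<le> s" using False \<open>b > 0\<close> by (simp add: s_def)
      have "s \<le> n * b / (8 * b)" unfolding s_def using Xt \<open>b > 0\<close> by (intro divide_right_mono) auto
      also have "\<dots> = n / 8" using \<open>b > 0\<close> by simp
      also have "\<dots> \<le> card U" using n \<open>n \<le> card U\<close> by simp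
      finally show "s \<le> card U" .
      have "s \<le> card X * b / (8 * b)" unfolding s_def using tb \<open>b > 0\<close>
        by (intro divide_right_mono mult_left_mono) auto
      also have "\<dots> \<le> card X" using \<open>b > 0\<close> by simp
      finally show "s \<le> card X" .
    qed
    have "t * real (card X) * l = (\<Sum>c\<in>A - {0}. \<Sum>x\<in>X. t)" by (simp add: l_def)
    also have "\<dots> \<le> (\<Sum>c\<in>A - {0}. \<Sum>x\<in>X. \<Sum>b\<in>B. of_bool (c * (x + b) \<in> U))"
    proof (intro sum_mono)
      fix c x assume "c \<in> A - {0}" "x \<in> X"
      have "t \<le> rep A B x" using X \<open>x \<in> X\<close> .
      also have "\<dots> \<le> (\<Sum>b\<in>B. of_bool (c * (x + b) \<in> U))"
        using \<open>c \<in> A - {0}\<close> \<open>finite B\<close>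
        by (simp only: rep_sum, intro sum_mono) (auto simp: U_def add.commute intro: set_times_intro)
      finally show "t \<le> (\<Sum>b\<in>B. of_bool (c * (x + b) \<in> U))" .
    qed
    also have "\<dots> = (\<Sum>c\<in>A - {0}. \<Sum>b\<in>B. \<Sum>x\<in>X. of_bool (c * (x + b) \<in> U))"
      by (rule sum.cong[OF refl]) (rule sum.swap)
    also have "\<dots> = (\<Sum>(c, b)\<in>L. real (card {x\<in>X. c * (x + b) \<in> U}))"
      using \<open>finite X\<close> by (simp add: L_def sum.cartesian_product Int_def split_def)
    also have "\<dots> \<le> 3 * s * card L + 4 * (real (card U) * card X)\<^sup>2 / s\<^sup>2"
      using s \<open>finite U\<close> assms finite_A by (intro grid_incidences_real) (auto simp: L_def)
    also have "\<dots> \<le> 4 * s * card L + 4 * (M * n * card X)\<^sup>2 / s\<^sup>2"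
      using card_prod s
      by (intro add_mono mult_right_mono mult_left_mono divide_right_mono power_mono)
         (auto simp: U_def n_def)
    also have "4 * s * card L = t * real (card X) * l / 2"
      using \<open>b > 0\<close> by (simp add: s_def L_def l_def b_def card_cartesian_product)
    also have "4 * (M * n * card X)\<^sup>2 / s\<^sup>2 = 256 * (M\<^sup>2 * n\<^sup>2 * b\<^sup>2) / t\<^sup>2"
    proof -
      have "card X > 0" using \<open>X \<noteq> {}\<close> \<open>finite X\<close> by (simp add: card_gt_0_iff)
      then show ?thesis using \<open>t > 0\<close> \<open>b > 0\<close>
        by (simp add: s_def power_mult_distrib power_divide field_simps)
    qed
    finally have "t * real (card X) * l / 2 \<le> 256 * (M\<^sup>2 * n\<^sup>2 * b\<^sup>2) / t\<^sup>2" by simp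
    then have "t ^ 3 * real (card X) * l \<le> 512 * (M\<^sup>2 * n\<^sup>2 * b\<^sup>2)"
      using \<open>t > 0\<close> by (simp add: field_simps power2_eq_square power3_eq_cube)
    also have "\<dots> \<le> 512 * (M\<^sup>2 * (n * (2 * l)) * b\<^sup>2)"
      using l n by (intro mult_left_mono mult_right_mono) (auto simp: power2_eq_square)
    finally have "t ^ 3 * real (card X) * l \<le> 1024 * (M\<^sup>2 * n * b\<^sup>2) * l" by (simp add: mult_ac)
    then show ?thesis using \<open>l > 0\<close> by (simp add: n_def b_def mult_ac)
  qed
qed simp

text \<open>Restricting to actual differences keeps the set finite even when
  \<open>t \<le> 0\<close>.\<close>

definition popular :: "real set \<Rightarrow> real \<Rightarrow> real set" where
  "popular B t = {x\<in>diff_set A B. t \<le> rep A B x}"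

lemma finite_popular [simp]: "finite B \<Longrightarrow> finite (popular B t)"
  using finite_A by (simp add: popular_def)

lemma card_popular:
  fixes t :: real
  assumes "finite B" "t > 0"
  shows "card (popular B t) \<le> 1024 * (M\<^sup>2 * card A * (card B)\<^sup>2) / t ^ 3"
  using card_rep_ge[of B "popular B t" t] assms
  by (simp add: pos_le_divide_eq) (simp add: popular_def)

lemma energy_le:
  assumes "finite B"
  shows "energy A B \<le> 10000 * (M * card A * card B powr (3/2))"
proof (cases "card B = 0")
  case True
  then show ?thesis using assms finite_A by (simp add: energy_def rep_def)
next
  case False
  define n where "n = real (card A)"
  define b where "b = real (card B)"
  \<comment> \<open>Values of \<open>rep\<close> below \<open>u\<close> contribute at most
    \<open>n * b * u\<close> by the first moment; those above contribute order
    \<open>M^2 n b^2 / u\<close>, a geometric series over dyadic levels. This \<open>u\<close>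
    balances the two.\<close>
  define u where "u = M * sqrt b"
  have "b > 0" using False by (simp add: b_def)
  have u: "u > 0" using \<open>b > 0\<close> M_ge_1 by (simp add: u_def)
  define S where "S = {x\<in>diff_set A B. u \<le> rep A B x}"
  have "finite S" using assms finite_A by (simp add: S_def)
  define R where "R = 1024 * (M\<^sup>2 * n * b\<^sup>2)"
  have "R \<ge> 0" unfolding R_def n_def by simp
  obtain J where J: "real (card A) / u < 2 ^ J" using real_arch_pow[of 2] by auto
  have "(\<Sum>x\<in>S. 1 * (real (rep A B x))\<^sup>2)
    \<le> (\<Sum>j<J. (2 ^ Suc j * u)\<^sup>2 * (\<Sum>x\<in>{x\<in>S. 2 ^ j * u \<le> rep A B x}. 1))"
  proof (rule sum_power_le_dyadic_sum)
    fix x assume "x \<in> S"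
    have "real (rep A B x) \<le> card A" using rep_le_left finite_A by simp
    also have "\<dots> < 2 ^ J * u" using J u by (simp add: pos_divide_less_eq)
    finally show "real (rep A B x) < 2 ^ J * u" .
  qed (use \<open>finite S\<close> u in \<open>auto simp: S_def\<close>)
  also have "\<dots> \<le> (\<Sum>j<J. 4 * R / u * (1 / 2) ^ j)"
  proof (rule sum_mono)
    fix j
    let ?t = "2 ^ j * u"
    have "(\<Sum>x\<in>{x\<in>S. ?t \<le> rep A B x}. 1) \<le> R / ?t ^ 3"
    proof -
      have "{x\<in>S. ?t \<le> rep A B x} \<subseteq> popular B ?t" by (auto simp: S_def popular_def)
      then have "card {x\<in>S. ?t \<le> rep A B x} \<le> card (popular B ?t)"
        using assms by (intro card_mono) auto
      also have "real \<dots> \<le> R / ?t ^ 3"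
        using card_popular[OF assms, of ?t] u by (simp add: R_def n_def b_def)
      finally show ?thesis by simp
    qed
    then have "(2 ^ Suc j * u)\<^sup>2 * (\<Sum>x\<in>{x\<in>S. ?t \<le> rep A B x}. 1) \<le> (2 * ?t)\<^sup>2 * (R / ?t ^ 3)"
      unfolding power_Suc mult.assoc by (rule mult_left_mono) simp
    also have "\<dots> = 4 * R / ?t" using u by (simp add: power2_eq_square power3_eq_cube)
    also have "\<dots> = 4 * R / u * (1 / 2) ^ j" by (simp add: power_divide)
    finally show "(2 ^ Suc j * u)\<^sup>2 * (\<Sum>x\<in>{x\<in>S. ?t \<le> rep A B x}. 1) \<le> 4 * R / u * (1 / 2) ^ j" .
  qed
  also have "\<dots> = 4 * R / u * (\<Sum>j<J. (1 / 2) ^ j)" by (simp add: sum_distrib_left)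
  also have "\<dots> \<le> 4 * R / u * 2"
  proof (rule mult_left_mono)
    have "(\<Sum>j<J. (1 / 2 :: real) ^ j) = 2 * (1 - (1 / 2) ^ J)"
      by (subst sum_gp_strict) simp
    then show "(\<Sum>j<J. (1 / 2 :: real) ^ j) \<le> 2" by simp
  qed (use \<open>R \<ge> 0\<close> u in simp)
  also have "\<dots> = 8192 * (M * n * (b * sqrt b))"
    using u \<open>b > 0\<close> M_ge_1 real_sqrt_mult_self[of b]
    by (simp add: R_def u_def field_simps power2_eq_square)
  finally have high: "(\<Sum>x\<in>S. (real (rep A B x))\<^sup>2) \<le> 8192 * (M * n * (b * sqrt b))" by simp
  have "(\<Sum>x\<in>diff_set A B - S. (real (rep A B x))\<^sup>2) \<le> (\<Sum>x\<in>diff_set A B - S. rep A B x * u)"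
    by (intro sum_mono) (auto simp: S_def power2_eq_square intro!: mult_left_mono)
  also have "\<dots> \<le> (\<Sum>x\<in>diff_set A B. rep A B x * u)"
    using u assms finite_A by (intro sum_mono2) auto
  also have "\<dots> = n * b * u"
    using assms finite_A by (simp add: sum_rep n_def b_def flip: sum_distrib_right)
  also have "\<dots> = M * n * (b * sqrt b)" by (simp add: u_def)
  finally have low: "(\<Sum>x\<in>diff_set A B - S. (real (rep A B x))\<^sup>2) \<le> M * n * (b * sqrt b)" .
  have "energy A B = (\<Sum>x\<in>diff_set A B - S. (real (rep A B x))\<^sup>2) + (\<Sum>x\<in>S. (real (rep A B x))\<^sup>2)"
    unfolding energy_def using assms finite_A by (intro sum.subset_diff) (auto simp: S_def)
  also have "\<dots> \<le> 8193 * (M * n * (b * sqrt b))" using low high by simp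
  also have "\<dots> \<le> 10000 * (M * n * (b * sqrt b))"
    using M_ge_1 \<open>b > 0\<close> by (intro mult_right_mono) (auto simp: n_def)
  also have "b * sqrt b = b powr (3/2)"
    using \<open>b > 0\<close> powr_add[of b 1 "1/2"] by (simp add: powr_half_sqrt)
  finally show ?thesis by (simp add: n_def b_def)
qed

lemma log_card_ge_1: "1 \<le> log 2 (card A)"
  using card_A by (simp add: le_log_iff)

text \<open>The cube of a level exactly cancels the decay of its level set, so every dyadic scale
  contributes equally; the logarithm counts the scales.\<close>

lemma third_moment_le:
  "(\<Sum>x\<in>diff_set A A. real (rep A A x) ^ 3) \<le> 16384 * (M\<^sup>2 * real (card A) ^ 3 * log 2 (card A))"
proof -
  define n where "n = real (card A)"
  define J where "J = nat \<lfloor>log 2 n\<rfloor> + 1"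
  have n: "n \<ge> 2" using card_A by (simp add: n_def)
  have L: "log 2 n \<ge> 1" using log_card_ge_1 by (simp add: n_def)
  have J: "real J \<le> 2 * log 2 n" "log 2 n < J" unfolding J_def using L by linarith+
  have "n < 2 ^ J"
  proof -
    have "n = 2 powr (log 2 n)" using n by simp
    also have "\<dots> < 2 powr J" using J by (intro powr_less_mono) auto
    finally show ?thesis by (simp add: powr_realpow)
  qed
  let ?S = "popular A 1"
  have "(\<Sum>x\<in>diff_set A A. real (rep A A x) ^ 3) = (\<Sum>x\<in>?S. real (rep A A x) ^ 3)"
    using finite_A by (intro sum.mono_neutral_right) (auto simp: popular_def not_le)
  also have "\<dots> = (\<Sum>x\<in>?S. 1 * real (rep A A x) ^ 3)" by simp
  also have "\<dots> \<le> (\<Sum>j<J. (2 ^ Suc j * 1) ^ 3 * (\<Sum>x\<in>{x\<in>?S. 2 ^ j * 1 \<le> real (rep A A x)}. 1))"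
  proof (rule sum_power_le_dyadic_sum)
    fix x
    have "real (rep A A x) \<le> n" using rep_le_left finite_A by (simp add: n_def)
    also have "\<dots> < 2 ^ J * 1" using \<open>n < 2 ^ J\<close> by simp
    finally show "real (rep A A x) < 2 ^ J * 1" .
  qed (use finite_A in \<open>auto simp: popular_def\<close>)
  also have "\<dots> \<le> (\<Sum>j<J. 8 * (1024 * (M\<^sup>2 * n * n\<^sup>2)))"
  proof (rule sum_mono)
    fix j
    let ?t = "2 ^ j :: real"
    have "{x\<in>?S. ?t \<le> rep A A x} = popular A ?t"
      by (auto simp: popular_def intro: order_trans[rotated])
    then have "(\<Sum>x\<in>{x\<in>?S. ?t \<le> rep A A x}. 1) \<le> 1024 * (M\<^sup>2 * n * n\<^sup>2) / ?t ^ 3"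
      using card_popular[OF finite_A, of ?t] by (simp add: n_def)
    then have "(2 * ?t) ^ 3 * (\<Sum>x\<in>{x\<in>?S. ?t \<le> rep A A x}. 1)
      \<le> (2 * ?t) ^ 3 * (1024 * (M\<^sup>2 * n * n\<^sup>2) / ?t ^ 3)" by (intro mult_left_mono) auto
    also have "\<dots> = 8 * (1024 * (M\<^sup>2 * n * n\<^sup>2))" by (simp add: power_mult_distrib)
    finally show "(2 ^ Suc j * 1) ^ 3 * (\<Sum>x\<in>{x\<in>?S. 2 ^ j * 1 \<le> real (rep A A x)}. 1)
      \<le> 8 * (1024 * (M\<^sup>2 * n * n\<^sup>2))" by simp
  qed
  also have "\<dots> = real J * (8192 * (M\<^sup>2 * n ^ 3))" by (simp add: power2_eq_square power3_eq_cube)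
  also have "\<dots> \<le> (2 * log 2 n) * (8192 * (M\<^sup>2 * n ^ 3))"
    using J n by (intro mult_right_mono) auto
  finally show ?thesis by (simp add: n_def mult_ac)
qed

section \<open>Second moment of representations over pairs of popular differences\<close>

lemma popular_minus: "x \<in> popular A t \<Longrightarrow> - x \<in> popular A t"
  by (auto simp: popular_def rep_minus diff_set_def intro: rev_image_eqI)

text \<open>Weight each pair by \<open>rep A A d' \<ge> t\<close> and write
  \<open>d' = d + p\<close> with \<open>p \<in> P\<close>. The condition becomes
  \<open>a + d + p \<in> A\<close>, which \<open>rep A P (a + d)\<close> counts; symmetry of
  \<open>D\<close> changes the sign of \<open>d\<close>, giving the form needed for
  \<open>energy_Cauchy_Schwarz\<close>.\<close>

lemma popular_triples:
  fixes t :: real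
  assumes "finite P" "t \<ge> 0"
  defines "D \<equiv> popular A t"
  shows "t * card {(d, d'). d \<in> D \<and> d' \<in> D \<and> d' - d \<in> P} \<le> (\<Sum>b\<in>D. \<Sum>a\<in>A. real (rep A P (a - b)))"
proof -
  have "finite D" using finite_A by (simp add: D_def)
  have "{(d, d'). d \<in> D \<and> d' \<in> D \<and> d' - d \<in> P} = (SIGMA d:D. {d'\<in>D. d' - d \<in> P})" by auto
  then have "t * card {(d, d'). d \<in> D \<and> d' \<in> D \<and> d' - d \<in> P} = (\<Sum>d\<in>D. \<Sum>d'\<in>{d'\<in>D. d' - d \<in> P}. t)"
    using \<open>finite D\<close> by (simp add: sum_distrib_left mult.commute)
  also have "\<dots> \<le> (\<Sum>d\<in>D. \<Sum>d'\<in>{d'\<in>D. d' - d \<in> P}. real (rep A A d'))"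
    by (intro sum_mono) (auto simp: D_def popular_def)
  also have "\<dots> = (\<Sum>d\<in>D. \<Sum>p\<in>{p\<in>P. d + p \<in> D}. real (rep A A (d + p)))"
    by (intro sum.cong refl sum.reindex_bij_witness[where i = "\<lambda>p. _ + p" and j = "\<lambda>d'. d' - _"]) auto
  also have "\<dots> \<le> (\<Sum>d\<in>D. \<Sum>p\<in>P. real (rep A A (d + p)))"
    using assms by (intro sum_mono sum_mono2) auto
  also have "\<dots> = (\<Sum>d\<in>D. \<Sum>p\<in>P. \<Sum>a\<in>A. of_bool (p + (a + d) \<in> A))"
    using finite_A by (simp only: rep_sum) (simp add: algebra_simps)
  also have "\<dots> = (\<Sum>d\<in>D. \<Sum>a\<in>A. \<Sum>p\<in>P. of_bool (p + (a + d) \<in> A))"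
    by (rule sum.cong[OF refl]) (rule sum.swap)
  also have "\<dots> = (\<Sum>d\<in>D. \<Sum>a\<in>A. real (rep A P (a + d)))"
    using assms by (simp only: rep_sum)
  also have "\<dots> = (\<Sum>b\<in>D. \<Sum>a\<in>A. real (rep A P (a - b)))"
    by (rule sum.reindex_bij_witness[where i = uminus and j = uminus]) (auto simp: D_def popular_minus)
  finally show ?thesis .
qed

lemma popular_triples_le:
  fixes t :: real
  assumes "finite P" "t > 0"
  defines "D \<equiv> popular A t"
  shows "real (card {(d, d'). d \<in> D \<and> d' \<in> D \<and> d' - d \<in> P})
    \<le> 10000 * (M * card A * (real (card D) * card P) powr (3/4)) / t"
proof -
  have "finite D" using finite_A by (simp add: D_def)
  define c where "c = 10000 * (M * card A)"
  have "c \<ge> 0" using M_ge_1 by (simp add: c_def)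
  have split: "x powr (3/2) = (x powr (3/4))\<^sup>2" for x :: real
    by (simp add: power2_eq_square flip: powr_add)
  let ?S = "\<Sum>b\<in>D. \<Sum>a\<in>A. real (rep A P (a - b))"
  have "?S\<^sup>2 \<le> energy A D * energy A P"
    using finite_A \<open>finite D\<close> \<open>finite P\<close> by (rule energy_Cauchy_Schwarz)
  also have "\<dots> \<le> (c * card D powr (3/2)) * (c * card P powr (3/2))"
    using energy_le[OF \<open>finite D\<close>] energy_le[OF \<open>finite P\<close>] \<open>c \<ge> 0\<close> M_ge_1
    by (intro mult_mono) (auto simp: c_def energy_def mult.assoc intro!: sum_nonneg)
  also have "\<dots> = (c * (real (card D) * card P) powr (3/4))\<^sup>2"
    by (simp add: split powr_mult power_mult_distrib) (simp add: power2_eq_square mult_ac)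
  finally have "?S \<le> c * (real (card D) * card P) powr (3/4)"
    by (rule power2_le_imp_le) (use \<open>c \<ge> 0\<close> in simp)
  then have "t * card {(d, d'). d \<in> D \<and> d' \<in> D \<and> d' - d \<in> P} \<le> c * (real (card D) * card P) powr (3/4)"
    using popular_triples[OF \<open>finite P\<close>, of t] \<open>t > 0\<close> by (simp add: D_def)
  then show ?thesis using \<open>t > 0\<close> by (simp add: c_def field_simps)
qed

lemma popular_second_moment:
  fixes \<Delta> R :: real
  assumes "\<Delta> > 0"
  defines "D \<equiv> popular A \<Delta>"
  defines "R \<equiv> 1024 * (M\<^sup>2 * real (card A) ^ 3) / \<Delta> ^ 3"
  shows "(\<Sum>d\<in>D. \<Sum>d'\<in>D. (real (rep A A (d' - d)))\<^sup>2)
    \<le> 300000 * (M * card A * \<Delta> * (card D * R) powr (3/4))"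
proof -
  have "finite D" using finite_A by (simp add: D_def)
  define c where "c = 10000 * (M * card A * \<Delta> * (card D * R) powr (3/4))"
  have "c \<ge> 0" using M_ge_1 assms by (simp add: c_def)
  have R: "R \<ge> 0" using assms by (simp add: R_def)
  have card_le: "card (popular A (2 ^ j * \<Delta>)) \<le> R * (1 / 8) ^ j" for j
  proof -
    have "card (popular A (2 ^ j * \<Delta>)) \<le> 1024 * (M\<^sup>2 * card A * (card A)\<^sup>2) / (2 ^ j * \<Delta>) ^ 3"
      using finite_A assms by (intro card_popular) auto
    also have "\<dots> = 1024 * (M\<^sup>2 * card A * (card A)\<^sup>2) / (\<Delta> ^ 3 * 8 ^ j)"
      by (simp add: power_mult_distrib power_mult[symmetric] mult.commute[of j] power_mult[of 2 3])
    finally show ?thesis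
      by (simp add: R_def power2_eq_square power3_eq_cube power_divide mult_ac)
  qed
  define r where "r p = real (rep A A (snd p - fst p))" for p
  define S where "S = {p\<in>D \<times> D. \<Delta> \<le> r p}"
  have "finite S" using \<open>finite D\<close> by (simp add: S_def)

  have "(\<Sum>p\<in>D \<times> D - S. (r p)\<^sup>2) \<le> (\<Sum>p\<in>D \<times> D - S. \<Delta> * r p)"
    by (intro sum_mono) (auto simp: S_def r_def power2_eq_square intro!: mult_right_mono)
  also have "\<dots> \<le> (\<Sum>p\<in>D \<times> D. \<Delta> * r p)"
    using \<open>finite D\<close> assms by (intro sum_mono2) (auto simp: r_def)
  also have "\<dots> = \<Delta> * energy A D"
    using finite_A \<open>finite D\<close> by (simp add: energy_eq r_def sum.cartesian_product split_def sum_distrib_left)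
  also have "\<dots> \<le> \<Delta> * (10000 * (M * card A * card D powr (3/2)))"
    using assms \<open>finite D\<close> by (intro mult_left_mono energy_le) auto
  \<comment> \<open>Half of the power of \<open>card D\<close> is traded for \<open>R\<close>, by
    \<open>card_le\<close> at \<open>j = 0\<close>, so that small and large values share the bound
    \<open>c\<close> up to a constant.\<close>
  also have "card D powr (3/2) = card D powr (3/4) * card D powr (3/4)" by (simp flip: powr_add)
  also have "\<Delta> * (10000 * (M * card A * (card D powr (3/4) * card D powr (3/4))))
    \<le> \<Delta> * (10000 * (M * card A * (card D powr (3/4) * R powr (3/4))))"
    using card_le[of 0] assms M_ge_1 by (intro mult_left_mono powr_mono2) auto
  also have "\<dots> = c" using R by (simp add: c_def powr_mult)
  finally have low: "(\<Sum>p\<in>D \<times> D - S. (r p)\<^sup>2) \<le> c" .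

  obtain J where J: "real (card A) / \<Delta> < 2 ^ J" using real_arch_pow[of 2] by auto
  \<comment> \<open>Doubling the level multiplies its square by 4 and the bound for its level set by
    1/8, the latter entering with exponent 3/4. The ratio is \<open>2 powr (-1/4)\<close>, so the
    series converges.\<close>
  define \<rho> :: real where "\<rho> = 4 * (1 / 8) powr (3/4)"
  have \<rho>: "\<rho> \<ge> 0" "\<rho> \<le> 17/20"
  proof -
    show "\<rho> \<ge> 0" by (simp add: \<rho>_def)
    have "\<rho> ^ 4 = 256 * (1 / 8) powr (3/4 * 4)"
      unfolding \<rho>_def by (simp add: power_mult_distrib powr_power)
    also have "\<dots> \<le> (17/20) ^ 4" by (simp add: power_divide)
    finally show "\<rho> \<le> 17/20" by (rule power_le_imp_le_base[where n = 3, simplified]) auto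
  qed
  have "(\<Sum>p\<in>S. 1 * (r p)\<^sup>2) \<le> (\<Sum>j<J. (2 ^ Suc j * \<Delta>)\<^sup>2 * (\<Sum>p\<in>{p\<in>S. 2 ^ j * \<Delta> \<le> r p}. 1))"
  proof (rule sum_power_le_dyadic_sum)
    fix p
    have "r p \<le> card A" using rep_le_left finite_A by (simp add: r_def)
    also have "\<dots> < 2 ^ J * \<Delta>" using J assms by (simp add: pos_divide_less_eq)
    finally show "r p < 2 ^ J * \<Delta>" .
  qed (use \<open>finite S\<close> assms in \<open>auto simp: S_def\<close>)
  also have "\<dots> \<le> (\<Sum>j<J. 4 * c * \<rho> ^ j)"
  proof (rule sum_mono)
    fix j
    let ?P = "popular A (2 ^ j * \<Delta>)"
    have "{p\<in>S. 2 ^ j * \<Delta> \<le> r p} \<subseteq> {(d, d'). d \<in> D \<and> d' \<in> D \<and> d' - d \<in> ?P}"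
    proof (clarsimp simp: S_def popular_def r_def)
      fix d d' assume "2 ^ j * \<Delta> \<le> rep A A (d' - d)"
      moreover have "0 < 2 ^ j * \<Delta>" using assms by simp
      ultimately have "rep A A (d' - d) \<noteq> 0" by linarith
      then show "d' - d \<in> diff_set A A" using rep_eq_0 by metis
    qed
    moreover have "finite {(d, d'). d \<in> D \<and> d' \<in> D \<and> d' - d \<in> ?P}"
      by (rule finite_subset[of _ "D \<times> D"]) (use \<open>finite D\<close> in auto)
    ultimately have "(\<Sum>p\<in>{p\<in>S. 2 ^ j * \<Delta> \<le> r p}. 1) \<le> real (card {(d, d'). d \<in> D \<and> d' \<in> D \<and> d' - d \<in> ?P})"
      by (simp add: card_mono)
    also have "\<dots> \<le> 10000 * (M * card A * (real (card D) * card ?P) powr (3/4)) / \<Delta>"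
      unfolding D_def using assms finite_A by (intro popular_triples_le) auto
    also have "\<dots> \<le> 10000 * (M * card A * (real (card D) * (R * (1 / 8) ^ j)) powr (3/4)) / \<Delta>"
      using assms M_ge_1 card_le by (intro divide_right_mono mult_left_mono powr_mono2) auto
    also have "\<dots> = c * ((1 / 8) ^ j) powr (3/4) / \<Delta>\<^sup>2"
    proof -
      have "(real (card D) * (R * (1 / 8) ^ j)) powr (3/4) = (card D * R) powr (3/4) * ((1 / 8) ^ j) powr (3/4)"
        unfolding mult.assoc[symmetric] by (rule powr_mult)
      then show ?thesis using assms(1) by (simp add: c_def power2_eq_square)
    qed
    finally have "(2 ^ Suc j * \<Delta>)\<^sup>2 * (\<Sum>p\<in>{p\<in>S. 2 ^ j * \<Delta> \<le> r p}. 1)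
      \<le> (2 ^ Suc j * \<Delta>)\<^sup>2 * (c * ((1 / 8) ^ j) powr (3/4) / \<Delta>\<^sup>2)" by (intro mult_left_mono) auto
    also have "\<dots> = 4 * c * (4 ^ j * ((1 / 8) ^ j) powr (3/4))"
      using assms by (simp add: power_mult_distrib power2_eq_square flip: power_mult_distrib)
    also have "4 ^ j * ((1 / 8) ^ j) powr (3/4) = \<rho> ^ j"
      by (simp add: \<rho>_def power_mult_distrib powr_power powr_powr mult.commute flip: powr_realpow)
    finally show "(2 ^ Suc j * \<Delta>)\<^sup>2 * (\<Sum>p\<in>{p\<in>S. 2 ^ j * \<Delta> \<le> r p}. 1) \<le> 4 * c * \<rho> ^ j" .
  qed
  also have "\<dots> = 4 * c * (\<Sum>j<J. \<rho> ^ j)" by (simp add: sum_distrib_left)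
  also have "\<dots> \<le> 4 * c * 7"
  proof (rule mult_left_mono)
    have "(\<Sum>j<J. \<rho> ^ j) = (1 - \<rho> ^ J) / (1 - \<rho>)" using \<rho> by (subst sum_gp_strict) auto
    also have "\<dots> \<le> 1 / (3/20)" using \<rho> by (intro frac_le) auto
    finally show "(\<Sum>j<J. \<rho> ^ j) \<le> 7" by simp
  qed (use \<open>c \<ge> 0\<close> in simp)
  finally have high: "(\<Sum>p\<in>S. (r p)\<^sup>2) \<le> 28 * c" by simp

  have "(\<Sum>d\<in>D. \<Sum>d'\<in>D. (real (rep A A (d' - d)))\<^sup>2) = (\<Sum>p\<in>D \<times> D. (r p)\<^sup>2)"
    by (simp add: sum.cartesian_product split_def r_def)
  also have "\<dots> = (\<Sum>p\<in>D \<times> D - S. (r p)\<^sup>2) + (\<Sum>p\<in>S. (r p)\<^sup>2)"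
    using \<open>finite D\<close> by (intro sum.subset_diff) (auto simp: S_def)
  also have "\<dots> \<le> 30 * c" using low high \<open>c \<ge> 0\<close> by simp
  finally show ?thesis by (simp add: c_def)
qed

text \<open>Insert the third and second moment bounds into
  \<open>popular_differences_moment\<close>. The fourth power clears the exponent 3/4; then the net
  factor \<open>\<Delta> ^ 5\<close> moves to the left and \<open>m ^ 3\<close> cancels.\<close>

lemma card_popular_improved:
  fixes \<Delta> :: real
  assumes "\<Delta> > 0"
  defines "D \<equiv> popular A \<Delta>"
  shows "\<Delta> ^ 37 * real (card D) ^ 21
    \<le> 16384 ^ 4 * 300000 ^ 4 * 1024 ^ 3 * (M ^ 18 * real (card A) ^ 49 * log 2 (card A) ^ 4)"
proof -
  define n where "n = real (card A)"
  define L where "L = log 2 n"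
  define m where "m = real (card D)"
  define R where "R = 1024 * (M\<^sup>2 * n ^ 3) / \<Delta> ^ 3"
  define E3 where "E3 = 16384 * (M\<^sup>2 * n ^ 3 * L)"
  define Q where "Q = 300000 * (M * n * \<Delta> * (m * R) powr (3/4))"
  have pos: "n > 0" "L \<ge> 1" "M > 0" "m \<ge> 0" "R \<ge> 0"
    using card_A log_card_ge_1 M_ge_1 assms by (auto simp: n_def L_def m_def R_def)
  have "(\<Delta> ^ 4 * m ^ 3)\<^sup>2 \<le> n ^ 6
    * ((\<Sum>x\<in>diff_set A A. real (rep A A x) ^ 3) * (\<Sum>d\<in>D. \<Sum>d'\<in>D. (real (rep A A (d' - d)))\<^sup>2))"
    unfolding n_def m_def using finite_A assms
    by (intro popular_differences_moment) (auto simp: D_def popular_minus, auto simp: popular_def)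
  also have "\<dots> \<le> n ^ 6 * (E3 * Q)"
    using third_moment_le popular_second_moment[OF assms(1)] pos
    by (intro mult_left_mono mult_mono)
       (auto simp: E3_def Q_def n_def L_def m_def R_def D_def intro!: sum_nonneg)
  finally have "(\<Delta> ^ 4 * m ^ 3)\<^sup>2 \<le> n ^ 6 * (E3 * Q)" .
  then have "((\<Delta> ^ 4 * m ^ 3)\<^sup>2) ^ 4 \<le> (n ^ 6 * (E3 * Q)) ^ 4" by (intro power_mono) auto
  also have "\<dots> = n ^ 24 * E3 ^ 4 * Q ^ 4" by (simp add: power_mult_distrib flip: power_mult)
  also have "Q ^ 4 = 300000 ^ 4 * (M ^ 4 * n ^ 4 * \<Delta> ^ 4 * (m * R) ^ 3)"
  proof -
    have "((m * R) powr (3/4)) ^ 4 = (m * R) ^ 3"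
    proof (cases "m * R = 0")
      case False
      then have "m * R > 0" using pos by (metis less_eq_real_def mult_nonneg_nonneg)
      then have "((m * R) powr (3/4)) powr real 4 = (m * R) powr real 3" by (simp add: powr_powr)
      then show ?thesis using \<open>m * R > 0\<close> by (simp only: powr_realpow powr_gt_zero)
    qed auto
    then show ?thesis by (simp add: Q_def power_mult_distrib)
  qed
  also have "(m * R) ^ 3 = m ^ 3 * (1024 ^ 3 * (M ^ 6 * n ^ 9)) / \<Delta> ^ 9"
    by (simp add: R_def power_mult_distrib power_divide flip: power_mult)
  finally have "((\<Delta> ^ 4 * m ^ 3)\<^sup>2) ^ 4 * \<Delta> ^ 5
    \<le> n ^ 24 * E3 ^ 4 * (300000 ^ 4 * (M ^ 4 * n ^ 4 * \<Delta> ^ 4 * (m ^ 3 * (1024 ^ 3 * (M ^ 6 * n ^ 9)) / \<Delta> ^ 9))) * \<Delta> ^ 5"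
    using assms by (intro mult_right_mono) auto
  also have "\<dots> = n ^ 24 * E3 ^ 4 * (300000 ^ 4 * (M ^ 4 * n ^ 4 * (m ^ 3 * (1024 ^ 3 * (M ^ 6 * n ^ 9)))))"
    using assms by (simp add: field_simps flip: power_add)
  also have "\<dots> = (16384 ^ 4 * 300000 ^ 4 * 1024 ^ 3 * (M ^ 18 * n ^ 49 * L ^ 4)) * m ^ 3"
    by (simp add: E3_def power_mult_distrib flip: power_mult) (simp add: algebra_simps flip: power_add)
  also have "((\<Delta> ^ 4 * m ^ 3)\<^sup>2) ^ 4 * \<Delta> ^ 5 = \<Delta> ^ 37 * m ^ 21 * m ^ 3"
    by (simp add: power_mult_distrib flip: power_mult) (simp add: algebra_simps flip: power_add)
  finally have *: "\<Delta> ^ 37 * m ^ 21 * m ^ 3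
    \<le> (16384 ^ 4 * 300000 ^ 4 * 1024 ^ 3 * (M ^ 18 * n ^ 49 * L ^ 4)) * m ^ 3" .
  show ?thesis
  proof (cases "m = 0")
    case True
    then have "\<Delta> ^ 37 * m ^ 21 = 0" by simp
    also have "\<dots> \<le> 16384 ^ 4 * 300000 ^ 4 * 1024 ^ 3 * (M ^ 18 * n ^ 49 * L ^ 4)"
      using pos by simp
    finally show ?thesis by (simp only: m_def n_def L_def)
  next
    case False
    then have "m ^ 3 > 0" using pos by simp
    with * show ?thesis unfolding m_def n_def L_def by (rule mult_right_le_imp_le)
  qed
qed

section \<open>Energy from the three ranges of representation counts\<close>

text \<open>By \<open>card_popular_improved\<close>, level \<open>t\<close> contributes order
  \<open>t^(2 - 37/21) = t^(5/21)\<close>, which grows with \<open>t\<close>, so the top scale near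
  \<open>T\<close> dominates. Stating the condition on \<open>Y\<close> in 21st powers avoids
  roots.\<close>

lemma truncated_energy_le:
  fixes T Y :: real
  assumes "T > 0" "Y \<ge> 0"
    and Y: "16384 ^ 4 * 300000 ^ 4 * 1024 ^ 3 * (M ^ 18 * real (card A) ^ 49 * log 2 (card A) ^ 4) * T ^ 5 \<le> Y ^ 21"
  shows "(\<Sum>x\<in>{x\<in>diff_set A A. rep A A x < T}. (real (rep A A x))\<^sup>2) \<le> 80 * Y"
\<comment> \<open>Counts are integers, so those below 1 vanish; afterwards \<open>log 2 T\<close> is
  positive.\<close>
proof (cases "T \<le> 1")
  case True
  have "rep A A x = 0" if "real (rep A A x) < T" for x
  proof -
    have "real (rep A A x) < 1" using that True by linarith
    then show ?thesis by simp
  qed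
  then have "(\<Sum>x\<in>{x\<in>diff_set A A. rep A A x < T}. (real (rep A A x))\<^sup>2) = 0"
    by (intro sum.neutral) simp
  then show ?thesis using assms by simp
next
  case False
  define \<kappa> where "\<kappa> = 16384 ^ 4 * 300000 ^ 4 * 1024 ^ 3 * (M ^ 18 * real (card A) ^ 49 * log 2 (card A) ^ 4)"
  have "\<kappa> \<ge> 0" using M_ge_1 log_card_ge_1 unfolding \<kappa>_def by (intro mult_nonneg_nonneg) auto
  define J where "J = nat \<lceil>log 2 T\<rceil>"
  have "log 2 T > 0" using False by simp
  then have J: "log 2 T \<le> J" "J \<le> log 2 T + 1" unfolding J_def by linarith+
  have T_le: "T \<le> 2 ^ J"
  proof -
    have "T = 2 powr (log 2 T)" using assms by simp
    also have "\<dots> \<le> 2 powr J" using J by (intro powr_mono) auto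
    finally show ?thesis by (simp add: powr_realpow)
  qed
  have le_T: "2 ^ J \<le> 2 * T"
  proof -
    have "2 ^ J = (2::real) powr J" by (simp add: powr_realpow)
    also have "\<dots> \<le> 2 powr (log 2 T + 1)" using J by (intro powr_mono) auto
    also have "\<dots> = 2 * T" using assms by (simp add: powr_add)
    finally show ?thesis .
  qed
  define \<sigma> :: real where "\<sigma> = 2 powr (5/21)"
  have \<sigma>: "\<sigma> \<ge> 11/10"
  proof -
    have "(11/10 :: real) ^ 21 \<le> 2 powr (5/21 * 21)" by (simp add: power_divide)
    also have "\<dots> = \<sigma> ^ 21" by (simp add: \<sigma>_def powr_power)
    finally show ?thesis by (rule power_le_imp_le_base[where n = 20, simplified]) (simp add: \<sigma>_def)
  qed
  define S where "S = {x\<in>diff_set A A. 1 \<le> real (rep A A x) \<and> real (rep A A x) < T}"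
  have "finite S" using finite_A by (simp add: S_def)
  have "(\<Sum>x\<in>{x\<in>diff_set A A. rep A A x < T}. (real (rep A A x))\<^sup>2) = (\<Sum>x\<in>S. 1 * (real (rep A A x))\<^sup>2)"
    using finite_A by (intro sum.mono_neutral_cong_right) (auto simp: S_def not_le)
  also have "\<dots> \<le> (\<Sum>j<J. (2 ^ Suc j * 1)\<^sup>2 * (\<Sum>x\<in>{x\<in>S. 2 ^ j * 1 \<le> real (rep A A x)}. 1))"
  proof (rule sum_power_le_dyadic_sum)
    fix x assume "x \<in> S"
    then have "real (rep A A x) < T" by (simp add: S_def)
    then show "real (rep A A x) < 2 ^ J * 1" using T_le by linarith
  qed (use \<open>finite S\<close> in \<open>auto simp: S_def\<close>)
  also have "\<dots> \<le> (\<Sum>j<J. 4 * \<kappa> powr (1/21) * \<sigma> ^ j)"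
  proof (rule sum_mono)
    fix j
    define t :: real where "t = 2 ^ j"
    have "t > 0" by (simp add: t_def)
    have "(\<Sum>x\<in>{x\<in>S. t \<le> real (rep A A x)}. 1) \<le> real (card (popular A t))"
      using finite_A by (simp, intro card_mono) (auto simp: S_def popular_def)
    also have "\<dots> = (real (card (popular A t)) ^ 21) powr (1/21)"
      by (cases "card (popular A t) = 0") (auto simp: powr_powr simp flip: powr_numeral)
    also have "\<dots> \<le> (\<kappa> / t ^ 37) powr (1/21)"
      using card_popular_improved[OF \<open>t > 0\<close>] \<open>t > 0\<close>
      by (intro powr_mono2) (auto simp: \<kappa>_def pos_le_divide_eq mult.commute)
    also have "\<dots> = \<kappa> powr (1/21) * t powr (- 37/21)"
      using \<open>\<kappa> \<ge> 0\<close> \<open>t > 0\<close> by (simp add: powr_divide powr_minus powr_powr divide_simps flip: powr_numeral)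
    finally have "(2 * t)\<^sup>2 * (\<Sum>x\<in>{x\<in>S. t \<le> real (rep A A x)}. 1)
      \<le> (2 * t)\<^sup>2 * (\<kappa> powr (1/21) * t powr (- 37/21))" by (intro mult_left_mono) auto
    also have "\<dots> = 4 * \<kappa> powr (1/21) * (t powr 2 * t powr (- 37/21))"
      using \<open>t > 0\<close> by (simp add: power_mult_distrib)
    also have "t powr 2 * t powr (- 37/21) = \<sigma> ^ j"
      by (simp add: t_def \<sigma>_def powr_powr powr_power mult.commute flip: powr_add powr_realpow)
    finally show "(2 ^ Suc j * 1)\<^sup>2 * (\<Sum>x\<in>{x\<in>S. 2 ^ j * 1 \<le> real (rep A A x)}. 1)
      \<le> 4 * \<kappa> powr (1/21) * \<sigma> ^ j" by (simp add: t_def)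
  qed
  also have "\<dots> = 4 * \<kappa> powr (1/21) * (\<Sum>j<J. \<sigma> ^ j)" by (simp add: sum_distrib_left)
  also have "\<dots> \<le> 4 * \<kappa> powr (1/21) * (20 * T powr (5/21))"
  proof (rule mult_left_mono)
    have "(\<Sum>j<J. \<sigma> ^ j) = (\<sigma> ^ J - 1) / (\<sigma> - 1)" using \<sigma> by (subst geometric_sum) auto
    also have "\<dots> \<le> \<sigma> ^ J / (1/10)" using \<sigma> by (intro frac_le) auto
    also have "\<sigma> ^ J = (2 ^ J) powr (5/21)"
      by (simp add: \<sigma>_def powr_powr powr_power mult.commute flip: powr_realpow)
    also have "(2 ^ J) powr (5/21) / (1/10) \<le> (2 * T) powr (5/21) / (1/10)"
      using le_T by (intro divide_right_mono powr_mono2) auto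
    also have "\<dots> = 10 * (2 powr (5/21) * T powr (5/21))" using assms by (simp add: powr_mult)
    also have "\<dots> \<le> 10 * (2 powr 1 * T powr (5/21))"
      by (intro mult_left_mono mult_right_mono powr_mono) auto
    finally show "(\<Sum>j<J. \<sigma> ^ j) \<le> 20 * T powr (5/21)" by simp
  qed simp
  also have "\<dots> = 80 * (\<kappa> powr (1/21) * (T ^ 5) powr (1/21))"
    using assms by (simp add: powr_powr flip: powr_numeral)
  also have "\<dots> = 80 * (\<kappa> * T ^ 5) powr (1/21)"
    using assms \<open>\<kappa> \<ge> 0\<close> by (simp add: powr_mult)
  also have "\<dots> \<le> 80 * (Y ^ 21) powr (1/21)"
    using Y \<open>\<kappa> \<ge> 0\<close> assms by (intro mult_left_mono powr_mono2) (auto simp: \<kappa>_def)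
  also have "(Y ^ 21) powr (1/21) = Y"
    using assms by (cases "Y = 0") (auto simp: powr_powr simp flip: powr_numeral)
  finally show ?thesis .
qed

lemma energy_le_cube: "energy A A \<le> real (card A) ^ 3"
proof -
  have "energy A A \<le> (\<Sum>x\<in>diff_set A A. rep A A x * real (card A))"
    unfolding energy_def using finite_A
    by (intro sum_mono) (auto simp: power2_eq_square intro!: mult_left_mono rep_le_left)
  then show ?thesis
    using finite_A by (simp add: sum_rep power3_eq_cube flip: sum_distrib_right)
qed

text \<open>Counts below \<open>T\<close> are handled by \<open>truncated_energy_le\<close>, those
  from \<open>T\<close> up to \<open>n powr (1 - \<epsilon>)\<close> by the third moment, and larger
  ones by the hypothesis at a cost of \<open>n\<^sup>2\<close> per difference. The difference 0 is
  treated separately.\<close>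

lemma energy_bound:
  fixes \<epsilon> C :: real
  defines "n \<equiv> real (card A)"
  defines "L \<equiv> log 2 n"
  defines "m \<equiv> M * log 2 M"
  defines "K \<equiv> 16384 ^ 4 * 300000 ^ 4 * 1024 ^ 3 * 16384 ^ 3 * 4 ^ 24 :: real"
  assumes \<epsilon>: "0 \<le> \<epsilon>" "\<epsilon> < 1" and C: "0 \<le> C" and M: "1 / 4 \<le> log 2 M"
    and pop: "real (card {x. x \<noteq> 0 \<and> n powr (1 - \<epsilon>) \<le> rep A A x})
      \<le> C * (m powr (5/3) * n powr (1/6 - \<epsilon>/4) * L powr (5/6))"
  shows "energy A A \<le> (6 + C + 80 * K) * (m * n powr (5/2 - \<epsilon>/12) * L powr (1/2))"
proof -
  define B where "B = m * n powr (5/2 - \<epsilon>/12) * L powr (1/2)"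
  have n: "n \<ge> 2" using card_A by (simp add: n_def)
  have L: "L \<ge> 1" using log_card_ge_1 by (simp add: L_def n_def)
  have mM: "M / 4 \<le> m" unfolding m_def using mult_left_mono[OF M, of M] M_ge_1 by simp
  then have m: "1 / 4 \<le> m" using M_ge_1 by simp
  have "B > 0" using m n L by (simp add: B_def)
  have K: "K \<ge> 1" by (simp add: K_def)
  \<comment> \<open>If \<open>m\<close> is large then the claim is weaker than the trivial bound \<open>n\<^sup>3\<close>.\<close>
  have "energy A A \<le> B \<or> n\<^sup>2 * card {x. x \<noteq> 0 \<and> n powr (1 - \<epsilon>) \<le> rep A A x} \<le> C * B"
  \<comment> \<open>Write \<open>m^(5/3) L^(5/6)\<close> as \<open>m L^(1/2) (m^2 L)^(1/3)\<close>.
    Below the threshold the last factor is at most \<open>n^(1/3 + \<epsilon>/6)\<close>, exactly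
    what lifts the exponent \<open>13/6 - \<epsilon>/4\<close> to
    \<open>5/2 - \<epsilon>/12\<close>.\<close>
  proof (cases "m\<^sup>2 * L \<le> n powr (1 + \<epsilon>/2)")
    case True
    have "n\<^sup>2 * card {x. x \<noteq> 0 \<and> n powr (1 - \<epsilon>) \<le> rep A A x}
      \<le> n\<^sup>2 * (C * (m powr (5/3) * n powr (1/6 - \<epsilon>/4) * L powr (5/6)))"
      using pop by (intro mult_left_mono) auto
    also have "m powr (5/3) = m * (m\<^sup>2) powr (1/3)"
      using m powr_add[of m 1 "2/3"] powr_powr[of m 2 "1/3"] by simp
    also have "L powr (5/6) = L powr (1/2) * L powr (1/3)" by (simp flip: powr_add)
    also have "n\<^sup>2 = n powr 2" using n by simp
    also have "n powr 2 * (C * (m * (m\<^sup>2) powr (1/3) * n powr (1/6 - \<epsilon>/4) * (L powr (1/2) * L powr (1/3))))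
      = C * m * L powr (1/2) * (n powr 2 * n powr (1/6 - \<epsilon>/4)) * (m\<^sup>2 * L) powr (1/3)"
      using L by (simp add: powr_mult mult_ac)
    also have "\<dots> \<le> C * m * L powr (1/2) * (n powr 2 * n powr (1/6 - \<epsilon>/4)) * (n powr (1 + \<epsilon>/2)) powr (1/3)"
      using True C m L by (intro mult_left_mono powr_mono2) auto
    also have "\<dots> = C * m * L powr (1/2) * (n powr 2 * n powr (1/6 - \<epsilon>/4) * n powr ((1 + \<epsilon>/2) * (1/3)))"
      by (simp only: powr_powr mult.assoc)
    also have "n powr 2 * n powr (1/6 - \<epsilon>/4) * n powr ((1 + \<epsilon>/2) * (1/3)) = n powr (5/2 - \<epsilon>/12)"
      unfolding powr_add[symmetric] by (rule arg_cong[where f = "(powr) n"]) (simp add: field_simps)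
    finally show ?thesis using n by (simp add: B_def mult_ac)
  next
    case False
    have "n powr (1/2 + \<epsilon>/4) = (n powr (1 + \<epsilon>/2)) powr (1/2)"
      by (simp add: powr_powr add_divide_distrib)
    also have "\<dots> \<le> (m\<^sup>2 * L) powr (1/2)" using False by (intro powr_mono2) auto
    also have "\<dots> = m * L powr (1/2)"
      using m L powr_powr[of m 2 "1/2"] by (simp add: powr_mult)
    finally have *: "n powr (1/2 + \<epsilon>/4) \<le> m * L powr (1/2)" .
    have "n ^ 3 = n powr 3" using n by simp
    also have "\<dots> \<le> n powr ((1/2 + \<epsilon>/4) + (5/2 - \<epsilon>/12))" using n \<epsilon> by (intro powr_mono) auto
    also have "\<dots> = n powr (1/2 + \<epsilon>/4) * n powr (5/2 - \<epsilon>/12)" by (rule powr_add)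
    also have "\<dots> \<le> m * L powr (1/2) * n powr (5/2 - \<epsilon>/12)" using * by (intro mult_right_mono) auto
    also have "\<dots> = B" by (simp add: B_def)
    finally show ?thesis using energy_le_cube by (simp add: n_def)
  qed
  then show ?thesis
  proof
    assume "energy A A \<le> B"
    also have "\<dots> \<le> (6 + C + 80 * K) * B" using C K \<open>B > 0\<close> by simp
    finally show ?thesis by (simp add: B_def)
  next
    assume popB: "n\<^sup>2 * card {x. x \<noteq> 0 \<and> n powr (1 - \<epsilon>) \<le> rep A A x} \<le> C * B"
    define r where "r x = real (rep A A x)" for x
    define \<beta> where "\<beta> = 16384 * (M\<^sup>2 * n ^ 3 * L)"
    have "\<beta> > 0" using M_ge_1 n L by (simp add: \<beta>_def)
    \<comment> \<open>Beyond \<open>\<beta> / B\<close> the third moment suffices. Below, \<open>T\<^sup>5\<close> is bounded by the square of the first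
      term times the cube of the second, which gives exactly the exponents of \<open>M\<close> and \<open>n\<close> in \<open>B\<close>.\<close>
    define T where "T = min (n powr (1 - \<epsilon>)) (\<beta> / B)"
    have "T > 0" using n \<open>\<beta> > 0\<close> \<open>B > 0\<close> by (simp add: T_def)
    define X where "X = diff_set A A"
    have "finite X" using finite_A by (simp add: X_def)
    define X1 where "X1 = {x\<in>X. r x < T}"
    define X2 where "X2 = {x\<in>X. T \<le> r x \<and> r x < n powr (1 - \<epsilon>)}"
    define P where "P = {x. x \<noteq> 0 \<and> n powr (1 - \<epsilon>) \<le> r x}"
    have r_le: "r x \<le> n" for x using rep_le_left finite_A by (simp add: r_def n_def)
    have "P \<subseteq> X"
    proof
      fix x assume "x \<in> P"
      then have "r x > 0" using n by (auto simp: P_def intro: less_le_trans[of 0 "n powr (1 - \<epsilon>)"])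
      then show "x \<in> X" using rep_eq_0[of x A A] by (auto simp: r_def X_def)
    qed
    then have "finite P" using \<open>finite X\<close> finite_subset by blast

    \<comment> \<open>This absorbs the contribution of the difference 0.\<close>
    have nB: "n\<^sup>2 \<le> 4 * B"
    proof -
      have "n\<^sup>2 = n powr 2" using n by simp
      also have "\<dots> \<le> n powr (5/2 - \<epsilon>/12)" using n \<epsilon> by (intro powr_mono) auto
      also have "\<dots> = 4 * (1/4 * n powr (5/2 - \<epsilon>/12) * 1)" by simp
      also have "\<dots> \<le> 4 * B"
        unfolding B_def using m L by (intro mult_left_mono mult_mono ge_one_powr_ge_zero) auto
      finally show ?thesis .
    qed

    have sum1: "(\<Sum>x\<in>X1. (r x)\<^sup>2) \<le> 80 * (K * B)"
    proof -
      define \<kappa> where "\<kappa> = 16384 ^ 4 * 300000 ^ 4 * 1024 ^ 3 * (M ^ 18 * n ^ 49 * L ^ 4)"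
      have "\<kappa> \<ge> 0" using M_ge_1 n L unfolding \<kappa>_def by (intro mult_nonneg_nonneg) auto
      \<comment> \<open>The exponent is 21, from the condition on \<open>Y\<close>, plus 3, from
        clearing the denominator of \<open>(\<beta> / B) ^ 3\<close>.\<close>
      have B24: "B ^ 24 = m ^ 24 * n powr (60 - 2 * \<epsilon>) * L ^ 12"
      proof -
        have "(n powr (5/2 - \<epsilon>/12)) ^ 24 = n powr (60 - 2 * \<epsilon>)" using n by (simp add: powr_power algebra_simps)
        moreover have "(L powr (1/2)) ^ 24 = L ^ 12" using L by (simp add: powr_power)
        ultimately show ?thesis by (simp add: B_def power_mult_distrib)
      qed
      have "T ^ 5 = T ^ 2 * T ^ 3" by (simp flip: power_add)
      also have "\<dots> \<le> (n powr (1 - \<epsilon>)) ^ 2 * (\<beta> / B) ^ 3"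
        using \<open>T > 0\<close> by (intro mult_mono power_mono) (auto simp: T_def)
      also have "(n powr (1 - \<epsilon>)) ^ 2 = n powr (2 - 2 * \<epsilon>)" using n by (simp add: powr_power algebra_simps)
      finally have "T ^ 5 * B ^ 3 \<le> n powr (2 - 2 * \<epsilon>) * \<beta> ^ 3"
        using \<open>B > 0\<close> by (simp add: power_divide pos_le_divide_eq)
      then have "\<kappa> * (T ^ 5 * B ^ 3) \<le> \<kappa> * (n powr (2 - 2 * \<epsilon>) * \<beta> ^ 3)"
        using \<open>\<kappa> \<ge> 0\<close> by (rule mult_left_mono)
      \<comment> \<open>\<open>K\<close> combines the constant of \<open>\<kappa>\<close>, the
        factor \<open>16384 ^ 3\<close> of \<open>\<beta> ^ 3\<close>, and \<open>4 ^ 24\<close>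
        from writing \<open>M\<close> as \<open>4 * (M / 4)\<close> to prepare for
        \<open>mM\<close>.\<close>
      also have "\<dots> = K * ((M / 4) ^ 24 * (n ^ 58 * n powr (2 - 2 * \<epsilon>)) * L ^ 7)"
        by (simp add: \<kappa>_def \<beta>_def K_def power_mult_distrib power_divide flip: power_mult)
           (simp add: algebra_simps flip: power_add)
      also have "n ^ 58 * n powr (2 - 2 * \<epsilon>) = n powr (60 - 2 * \<epsilon>)"
        using n powr_add[of n 58 "2 - 2 * \<epsilon>"] by simp
      also have "K * ((M / 4) ^ 24 * n powr (60 - 2 * \<epsilon>) * L ^ 7) \<le> K * (m ^ 24 * n powr (60 - 2 * \<epsilon>) * L ^ 12)"
        using K mM M_ge_1 L by (intro mult_left_mono mult_mono power_mono power_increasing) auto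
      also have "\<dots> = K * B ^ 24" by (simp only: B24)
      also have "\<dots> \<le> K ^ 21 * B ^ 24"
        using K \<open>B > 0\<close> power_increasing[of 1 21 K] by (intro mult_right_mono) auto
      also have "\<dots> = (K * B) ^ 21 * B ^ 3" by (simp add: power_mult_distrib flip: power_add)
      finally have "\<kappa> * T ^ 5 \<le> (K * B) ^ 21" using \<open>B > 0\<close> by (simp flip: mult.assoc)
      then show ?thesis
        using truncated_energy_le[of T "K * B"] \<open>T > 0\<close> K \<open>B > 0\<close>
        by (simp add: X1_def X_def r_def \<kappa>_def n_def L_def)
    qed

    have sum2: "(\<Sum>x\<in>X2. (r x)\<^sup>2) \<le> B"
    proof (cases "X2 = {}")
      case True
      then show ?thesis using \<open>B > 0\<close> by simp
    next
      case False
      \<comment> \<open>A nonempty middle range forces \<open>T < n powr (1 - \<epsilon>)\<close>,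
        so the minimum is the other term.\<close>
      then have T: "T = \<beta> / B" by (auto simp: X2_def T_def min_def split: if_splits)
      have "T * (\<Sum>x\<in>X2. (r x)\<^sup>2) = (\<Sum>x\<in>X2. T * (r x)\<^sup>2)" by (rule sum_distrib_left)
      also have "\<dots> \<le> (\<Sum>x\<in>X2. r x ^ 3)"
        by (intro sum_mono) (auto simp: X2_def power3_eq_cube power2_eq_square mult.assoc intro!: mult_right_mono)
      also have "\<dots> \<le> (\<Sum>x\<in>X. r x ^ 3)"
        using \<open>finite X\<close> by (intro sum_mono2) (auto simp: X2_def r_def)
      also have "\<dots> \<le> \<beta>" using third_moment_le by (simp add: X_def r_def \<beta>_def n_def L_def)
      also have "\<beta> = T * B" using \<open>B > 0\<close> by (simp add: T)
      finally show ?thesis using \<open>T > 0\<close> by simp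
    qed

    have sum3: "(\<Sum>x\<in>insert 0 P. (r x)\<^sup>2) \<le> n\<^sup>2 + C * B"
    proof -
      have "(\<Sum>x\<in>insert 0 P. (r x)\<^sup>2) \<le> (\<Sum>x\<in>insert 0 P. n\<^sup>2)"
        using r_le by (intro sum_mono power_mono) (auto simp: r_def)
      also have "\<dots> = n\<^sup>2 + n\<^sup>2 * card P" using \<open>finite P\<close> by (subst sum.insert) (auto simp: P_def)
      finally show ?thesis using popB by (simp add: P_def r_def)
    qed

    have union: "(\<Sum>x\<in>S \<union> S'. (r x)\<^sup>2) \<le> (\<Sum>x\<in>S. (r x)\<^sup>2) + (\<Sum>x\<in>S'. (r x)\<^sup>2)"
      if "finite S" "finite S'" for S S'
      using sum.union_inter[OF that, of "\<lambda>x. (r x)\<^sup>2"] sum_nonneg[of "S \<inter> S'" "\<lambda>x. (r x)\<^sup>2"] by simp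
    have "energy A A \<le> (\<Sum>x\<in>X1 \<union> X2 \<union> insert 0 P. (r x)\<^sup>2)"
      unfolding energy_def X_def[symmetric] r_def[symmetric]
      using \<open>finite X\<close> \<open>finite P\<close> by (intro sum_mono2) (auto simp: X1_def X2_def P_def)
    also have "\<dots> \<le> (\<Sum>x\<in>X1 \<union> X2. (r x)\<^sup>2) + (\<Sum>x\<in>insert 0 P. (r x)\<^sup>2)"
      using \<open>finite X\<close> \<open>finite P\<close> by (intro union) (auto simp: X1_def X2_def)
    also have "(\<Sum>x\<in>X1 \<union> X2. (r x)\<^sup>2) \<le> (\<Sum>x\<in>X1. (r x)\<^sup>2) + (\<Sum>x\<in>X2. (r x)\<^sup>2)"
      using \<open>finite X\<close> by (intro union) (auto simp: X1_def X2_def)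
    finally have "energy A A \<le> (6 + C + 80 * K) * B"
      using sum1 sum2 sum3 nB \<open>B > 0\<close> by (simp add: algebra_simps)
    then show ?thesis by (simp add: B_def)
  qed
qed

end

(* The product set AA is A * A from Set_Algebras.  Both Vinogradov symbols are made explicit:
   C is the implied constant of the hypothesis, D that of the conclusion; D depends on C only.
   The degenerate value M = 1 is excluded: there log M = 0, so the right-hand side of the
   conclusion vanishes, whereas the energy of a nonempty finite set is positive
   (e.g. A = {1} satisfies all hypotheses with M = 1). *)
theorem theorem49:
  shows "\<forall>C::real. C > 0 \<longrightarrow> (\<exists>D::real. D > 0 \<and>
    (\<forall>(A::real set) (\<epsilon>::real) (M::real).
       finite A \<and> 0 \<le> \<epsilon> \<and> \<epsilon> < 1 \<and>
       real (card (A * A)) = M * real (card A) \<and> M > 1 \<and>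
       real (card {x. x \<noteq> 0 \<and> real (diff_conv A x) \<ge> real (card A) powr (1 - \<epsilon>)})
         \<le> C * ((M * log 2 M) powr (5/3) * real (card A) powr (1/6 - \<epsilon>/4)
                * (log 2 (real (card A))) powr (5/6))
       \<longrightarrow>
       real (additive_energy A)
         \<le> D * (M * log 2 M * real (card A) powr (5/2 - \<epsilon>/12)
                * (log 2 (real (card A))) powr (1/2))))"
proof (intro allI impI)
  fix C :: real
  assume "C > 0"
  define D :: real where
    "D = 6 + C + 80 * (16384 ^ 4 * 300000 ^ 4 * 1024 ^ 3 * 16384 ^ 3 * 4 ^ 24)"
  have "real (additive_energy A) \<le> D * (M * log 2 M * real (card A) powr (5/2 - \<epsilon>/12)
      * (log 2 (real (card A))) powr (1/2))"
    if "finite A" "0 \<le> \<epsilon>" "\<epsilon> < 1" and AA: "real (card (A * A)) = M * real (card A)" and "M > 1"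
      and pop: "real (card {x. x \<noteq> 0 \<and> real (diff_conv A x) \<ge> real (card A) powr (1 - \<epsilon>)})
         \<le> C * ((M * log 2 M) powr (5/3) * real (card A) powr (1/6 - \<epsilon>/4)
                * (log 2 (real (card A))) powr (5/6))"
    for A :: "real set" and \<epsilon> M :: real
  proof (cases "card A \<ge> 2")
    case True
    interpret few_products A M using that True by unfold_locales auto
    \<comment> \<open>Strict growth is upgraded by \<open>product_set_growth\<close> to
      \<open>M \<ge> 6/5\<close>, uniformly in \<open>A\<close>.\<close>
    have "real (card A) < M * real (card A)" using True \<open>M > 1\<close> by simp
    then have "card A < card (A * A)" using AA by simp
    then have "6 / 5 * real (card A) \<le> M * real (card A)"
      using product_set_growth[OF \<open>finite A\<close>] AA by simp
    then have "6 / 5 \<le> M" using True by (simp add: mult_le_cancel_right)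
    then have "1 / 4 \<le> log 2 M" by (rule log_ge_quarter)
    then show ?thesis
      using energy_bound[of \<epsilon> C] that \<open>C > 0\<close>
      by (simp add: additive_energy_eq diff_conv_eq_rep D_def)
  next
    case False
    then consider "card A = 0" | "card A = 1" by linarith
    then show ?thesis
    proof cases
      case 1
      then have "A = {}" using \<open>finite A\<close> by simp
      then show ?thesis by (simp add: additive_energy_eq energy_def diff_set_def)
    next
      case 2
      \<comment> \<open>A singleton has as many products as elements, contradicting
        \<open>M > 1\<close>.\<close>
      then obtain a where "A = {a}" by (auto simp: card_1_singleton_iff)
      then have "A * A = {a * a}" by (auto simp: set_times_def)
      then show ?thesis using AA \<open>M > 1\<close> 2 by simp
    qed
  qed
  moreover have "D > 0" using \<open>C > 0\<close> by (simp add: D_def)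
  ultimately show "\<exists>D::real. D > 0 \<and>
    (\<forall>(A::real set) (\<epsilon>::real) (M::real).
       finite A \<and> 0 \<le> \<epsilon> \<and> \<epsilon> < 1 \<and>
       real (card (A * A)) = M * real (card A) \<and> M > 1 \<and>
       real (card {x. x \<noteq> 0 \<and> real (diff_conv A x) \<ge> real (card A) powr (1 - \<epsilon>)})
         \<le> C * ((M * log 2 M) powr (5/3) * real (card A) powr (1/6 - \<epsilon>/4)
                * (log 2 (real (card A))) powr (5/6))
       \<longrightarrow>
       real (additive_energy A)
         \<le> D * (M * log 2 M * real (card A) powr (5/2 - \<epsilon>/12)
                * (log 2 (real (card A))) powr (1/2)))"
    by blast
qed

end
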